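(* Let $\mathfrak{M}=\langle Ev,IM,IOb,Q,+,\cdot,\le,C,P\rangle$ be a model satisfying all of Borisov's Axioms except possibly Axiom III (that is, satisfying BA1, BA2, BA3, BA4, Axiom I, Axiom II and Axiom IV), whose quantity structure $\mathfrak{Q}=(Q,+,\cdot,\le)$ is the ordered field $\mathbb{R}$ of real numbers. Then there are two possibilities for the set $\mathbb{W}=\{f_{kh}:k,h\in IOb\}$ of worldview transformations: either $\mathbb{W}=\mathrm{Gal}^{\uparrow}_{\mathbb{R}}$, or else $\mathbb{W}={}_c\mathrm{Poi}^{\uparrow}_{\mathbb{R}}$ for some $c>0$.
   Context: Models. A model is $\mathfrak{M}=\langle Ev,IM,IOb,Q,+,\cdot,\le,C,P\rangle$ with nonempty sets $Ev$ (events), $IM$ (inertial motions), $IOb$ (inertial observers), quantities $\mathfrak{Q}=(Q,+,\cdot,\le)$, and relations $C\subseteq IOb\times Ev\times Q^4$, $P\subseteq IM\times Ev$. For $k\in IOb$ let $C_k=\{(e,\vec p):C(k,e,\vec p)\}$; when all $C_k$ are bijections $Ev\to Q^4$, put $f_{kh}=C_k\circ C_h^{-1}:Q^4\to Q^4$ (worldview transformation) and $\mathrm{wl}_k(i)=C_k[\{e\in Ev: P(i,e)\}]$ (worldline of $i$ according to $k$). For $\vec p=(p_0,p_1,p_2,p_3)\in Q^4$, $p_t=p_0$ and $\vec p_s=(p_1,p_2,p_3)$. A line is a set $\{\vec p+\lambda\vec v:\lambda\in Q\}$ with $\vec v\ne 0$; it is vertical if $\vec p_s=\vec q_s$ for all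 its points $\vec p,\vec q$, and of finite slope if it has points $\vec p,\vec q$ with $p_t\neq q_t$. Motion $i$ is stationary w.r.t. $k$ if $\mathrm{wl}_k(i)$ is a vertical line; $h$ is at rest w.r.t. $k$ if every $i\in IM$ stationary w.r.t. $h$ is stationary w.r.t. $k$. Transformations. Let $\cdot$ be the usual scalar product, and for $c>0$ let $\vec p\diamond_c\vec q=c^2p_tq_t-\vec p_s\cdot\vec q_s$. A $c$-Poincaré transformation is a composition of a translation and a linear map $Q^4\to Q^4$ preserving $\diamond_c$. A Galilean transformation is a composition of a translation and a linear map $T:Q^4\to Q^4$ with $|(T\vec p)_t|=|p_t|$ for all $\vec p$ and $T\vec p\cdot T\vec q=\vec p\cdot\vec q$ whenever $p_t=q_t=0$. A trivial transformation is a composition of a translation and a linear map preserving the usual scalar product on $Q^4$, which takes vertical lines to vertical lines. $T:Q^4\to Q^4$ is orthochronous if $T(1,0,0,0)_t>T(0,0,0,0)_t$. $\mathrm{Gal}^{\uparrow}_{\mathfrak{Q}}$, ${}_c\mathrm{Poi}^{\uparrow}_{\mathfrak{Q}}$, $\mathrm{Triv}^{\uparrow}_{\mathfrak{Q}}$ are the sets of orthochronous Galilean, $c$-Poincaré and trivial transformations over $\mathfrak{Q}$. The axioms are: BA1: $\mathfrak{Q}$ is an ordered field. BA2: for every $k\in IOb$, $C_k$ is a bijection $Ev\to Q^4$. BA3: for every vertical line $\ell$ and $k\in IOb$ there is $i\in IM$ with $\mathrm{wl}_k(i)=\ell$. BA4: for all $i\in IM$, $k\in IOb$, $\mathrm{wl}_k(i)$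 is a line of finite slope. Axiom I: there are $k,h\in IOb$ with $h$ not at rest w.r.t. $k$. Axiom II: (a) for all $k\in IOb$ and $\varphi\in\mathrm{Triv}^{\uparrow}_{\mathfrak{Q}}$ there is $h\in IOb$ with $f_{kh}=\varphi$; (b) for all $k,h\in IOb$, if $h$ is at rest w.r.t. $k$ then $f_{kh}\in\mathrm{Triv}^{\uparrow}_{\mathfrak{Q}}$. Axiom III (not assumed here): for all $i\in IM$, $k\in IOb$, $\varphi\in\mathrm{Triv}^{\uparrow}_{\mathfrak{Q}}$ there is $i'\in IM$ with $\mathrm{wl}_k(i')=\varphi[\mathrm{wl}_k(i)]$. Axiom IV: for all $k,k',h\in IOb$ there is $h'\in IOb$ with $f_{hh'}=f_{kk'}$. *)

theory Defs
  imports "HOL-Analysis.Analysis"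
begin

section \<open>Coordinate space\<close>

text \<open>
  Quantities are a type of class \<^class>\<open>linordered_field\<close>; this is how the axiom that the
  quantities form an ordered field is expressed.  Coordinates live in \<open>'q ^ 4\<close>, whose index type
  has the elements \<open>0, 1, 2, 3\<close> (with \<open>4 = 0\<close>); component \<open>0\<close> is time.  In particular
  \<open>vector [a, b, c, d]\<close> would put the time component last.
\<close>

definition tm :: "'q ^ 4 \<Rightarrow> 'q" where
  "tm p = p $ 0"

definition sp :: "'q::zero ^ 4 \<Rightarrow> 'q ^ 3" where
  "sp p = vector [p $ 1, p $ 2, p $ 3]"

definition sdot :: "'q::linordered_field ^ 'n \<Rightarrow> 'q ^ 'n \<Rightarrow> 'q" where
  "sdot p q = (\<Sum>i\<in>UNIV. p $ i * q $ i)"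

definition mink :: "'q::linordered_field \<Rightarrow> 'q ^ 4 \<Rightarrow> 'q ^ 4 \<Rightarrow> 'q" where
  "mink c p q = c\<^sup>2 * tm p * tm q - sdot (sp p) (sp q)"

lemma sdot_real: "sdot p q = p \<bullet> q" for p q :: "real ^ 'n"
  by (simp add: sdot_def inner_vec_def)

lemma linear_vec_real:
  "Vector_Spaces.linear (*s) (*s) L \<longleftrightarrow> linear L" for L :: "real ^ 'n \<Rightarrow> real ^ 'm"
  by (simp add: linear_def scalar_mult_eq_scaleR[abs_def])

definition is_line :: "('q::linordered_field ^ 4) set \<Rightarrow> bool" where
  "is_line l \<longleftrightarrow> (\<exists>p v. v \<noteq> 0 \<and> l = {p + r *s v | r. True})"

definition vertical_line :: "('q::linordered_field ^ 4) set \<Rightarrow> bool" where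
  "vertical_line l \<longleftrightarrow> is_line l \<and> (\<forall>p\<in>l. \<forall>q\<in>l. sp p = sp q)"

definition finite_slope_line :: "('q::linordered_field ^ 4) set \<Rightarrow> bool" where
  "finite_slope_line l \<longleftrightarrow> is_line l \<and> (\<exists>p\<in>l. \<exists>q\<in>l. tm p \<noteq> tm q)"

section \<open>Transformations\<close>

type_synonym 'q trafo = "'q ^ 4 \<Rightarrow> 'q ^ 4"

definition Poi :: "'q::linordered_field \<Rightarrow> 'q trafo set" where
  "Poi c = {T. \<exists>a L. Vector_Spaces.linear (*s) (*s) L
      \<and> (\<forall>p q. mink c (L p) (L q) = mink c p q)
      \<and> T = (+) a \<circ> L}"

definition Gal :: "'q::linordered_field trafo set" where
  "Gal = {T. \<exists>a L. Vector_Spaces.linear (*s) (*s) L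
      \<and> (\<forall>p. \<bar>tm (L p)\<bar> = \<bar>tm p\<bar>)
      \<and> (\<forall>p q. tm p = 0 \<and> tm q = 0 \<longrightarrow> sdot (L p) (L q) = sdot p q)
      \<and> T = (+) a \<circ> L}"

definition Triv :: "'q::linordered_field trafo set" where
  "Triv = {T. (\<exists>a L. Vector_Spaces.linear (*s) (*s) L
      \<and> (\<forall>p q. sdot (L p) (L q) = sdot p q)
      \<and> T = (+) a \<circ> L)
      \<and> (\<forall>l. vertical_line l \<longrightarrow> vertical_line (T ` l))}"

definition orthochronous :: "'q::linordered_field trafo \<Rightarrow> bool" where
  "orthochronous T \<longleftrightarrow> tm (T (axis 0 1)) > tm (T 0)"

definition Poi_up :: "'q::linordered_field \<Rightarrow> 'q trafo set" where
  "Poi_up c = {T \<in> Poi c. orthochronous T}"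

definition Gal_up :: "'q::linordered_field trafo set" where
  "Gal_up = {T \<in> Gal. orthochronous T}"

definition Triv_up :: "'q::linordered_field trafo set" where
  "Triv_up = {T \<in> Triv. orthochronous T}"

section \<open>Models\<close>

record ('e, 'i, 'o, 'q) model =
  Ev :: "'e set"
  IM :: "'i set"
  IOb :: "'o set"
  Crel :: "('o \<times> 'e \<times> ('q ^ 4)) set"
  Prel :: "('i \<times> 'e) set"

definition is_model :: "('e, 'i, 'o, 'q) model \<Rightarrow> bool" where
  "is_model M \<longleftrightarrow> Ev M \<noteq> {} \<and> IM M \<noteq> {} \<and> IOb M \<noteq> {}
     \<and> Crel M \<subseteq> IOb M \<times> Ev M \<times> UNIV \<and> Prel M \<subseteq> IM M \<times> Ev M"

definition coord :: "('e, 'i, 'o, 'q) model \<Rightarrow> 'o \<Rightarrow> ('e \<times> ('q ^ 4)) set" where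
  "coord M k = {(e, p). (k, e, p) \<in> Crel M}"

text \<open>
  The function whose graph is the composite of the inverse of \<open>coord M h\<close> followed by \<open>coord M k\<close>;
  it is only meaningful when both relations are (graphs of) bijections.
\<close>

definition worldview :: "('e, 'i, 'o, 'q) model \<Rightarrow> 'o \<Rightarrow> 'o \<Rightarrow> 'q trafo" where
  "worldview M k h p = (THE q. (p, q) \<in> (coord M h)\<inverse> O coord M k)"

definition worldline :: "('e, 'i, 'o, 'q) model \<Rightarrow> 'o \<Rightarrow> 'i \<Rightarrow> ('q ^ 4) set" where
  "worldline M k i = coord M k `` {e \<in> Ev M. (i, e) \<in> Prel M}"

definition stationary :: "('e, 'i, 'o, 'q::linordered_field) model \<Rightarrow> 'i \<Rightarrow> 'o \<Rightarrow> bool" where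
  "stationary M i k \<longleftrightarrow> vertical_line (worldline M k i)"

text \<open>\<open>at_rest M h k\<close>: observer \<open>h\<close> is at rest with respect to \<open>k\<close>.\<close>

definition at_rest :: "('e, 'i, 'o, 'q::linordered_field) model \<Rightarrow> 'o \<Rightarrow> 'o \<Rightarrow> bool" where
  "at_rest M h k \<longleftrightarrow> (\<forall>i\<in>IM M. stationary M i h \<longrightarrow> stationary M i k)"

definition worldviews :: "('e, 'i, 'o, 'q) model \<Rightarrow> 'q trafo set" where
  "worldviews M = {worldview M k h | k h. k \<in> IOb M \<and> h \<in> IOb M}"

section \<open>Axioms\<close>

definition BA2 :: "('e, 'i, 'o, 'q) model \<Rightarrow> bool" where
  "BA2 M \<longleftrightarrow> (\<forall>k\<in>IOb M. (\<forall>e\<in>Ev M. \<exists>!p. (e, p) \<in> coord M k)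
                         \<and> (\<forall>p. \<exists>!e. e \<in> Ev M \<and> (e, p) \<in> coord M k))"

definition BA3 :: "('e, 'i, 'o, 'q::linordered_field) model \<Rightarrow> bool" where
  "BA3 M \<longleftrightarrow> (\<forall>l. \<forall>k\<in>IOb M. vertical_line l \<longrightarrow> (\<exists>i\<in>IM M. worldline M k i = l))"

definition BA4 :: "('e, 'i, 'o, 'q::linordered_field) model \<Rightarrow> bool" where
  "BA4 M \<longleftrightarrow> (\<forall>i\<in>IM M. \<forall>k\<in>IOb M. finite_slope_line (worldline M k i))"

definition AxI :: "('e, 'i, 'o, 'q::linordered_field) model \<Rightarrow> bool" where
  "AxI M \<longleftrightarrow> (\<exists>k\<in>IOb M. \<exists>h\<in>IOb M. \<not> at_rest M h k)"

definition AxII :: "('e, 'i, 'o, 'q::linordered_field) model \<Rightarrow> bool" where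
  "AxII M \<longleftrightarrow>
     (\<forall>k\<in>IOb M. \<forall>\<phi>\<in>Triv_up. \<exists>h\<in>IOb M. worldview M k h = \<phi>)
   \<and> (\<forall>k\<in>IOb M. \<forall>h\<in>IOb M. at_rest M h k \<longrightarrow> worldview M k h \<in> Triv_up)"

definition AxIV :: "('e, 'i, 'o, 'q) model \<Rightarrow> bool" where
  "AxIV M \<longleftrightarrow> (\<forall>k\<in>IOb M. \<forall>k'\<in>IOb M. \<forall>h\<in>IOb M. \<exists>h'\<in>IOb M. worldview M h h' = worldview M k k')"

end

theory Submission
  imports Defs
begin

text \<open>
  The worldview transformations form a group \<open>W\<close> of bijections that contains the trivial
  transformations and takes vertical lines to lines of finite slope.  Some element of \<open>W\<close> tilts a
  vertical line, so by isotropy every element takes all lines of some positive speed \<open>v\<close> to lines.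
  A vertical line and two lines of opposite velocities with this speed lie in one plane; as in the
  fundamental theorem of affine geometry, this makes every element of \<open>W\<close> affine (the field
  automorphism that comes up is the identity on the reals).

  For the linear part \<open>G\<close> of \<open>W\<close> consider the orbit of the unit time vector \<open>e\<close>.  Since the stabiliser
  of the time axis fixes \<open>e\<close>, the orbit meets each ray once, and its points are determined by
  their speed up to rotation.  Conjugates in \<open>G\<close> of spatial reflections are involutions, and such an
  involution can only be the map \<open>swap e x\<close> exchanging \<open>e\<close> and its image \<open>x\<close>.  It preserves
  the form \<open>t\<^sup>2 - \<kappa> s\<^sup>2\<close> with \<open>\<kappa> = (t\<^sup>2 - 1) / s\<^sup>2\<close> evaluated at \<open>x\<close>.  Conjugating reflections by one
  swap yields an interval of speeds starting at \<open>0\<close>, so \<open>\<kappa>\<close> is the same for all swaps; it is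
  nonnegative because otherwise a doubled rotation would make \<open>e\<close> purely spatial.  Doubling shows
  that all future unit vectors of the form occur, and no other vector can lie in the orbit.
  Hence \<open>G\<close> is the Galilean or the Lorentz group with \<open>c = 1 / sqrt \<kappa>\<close>.
\<close>

section \<open>Maps taking the lines of a cone to lines\<close>

lemma image_range_rescale:
  fixes p v :: "'a::real_vector"
  assumes "c \<noteq> 0" shows "range (\<lambda>r. f (p + r *\<^sub>R (c *\<^sub>R v))) = range (\<lambda>r. f (p + r *\<^sub>R v))"
proof -
  have "range (\<lambda>r. f (p + r *\<^sub>R (c *\<^sub>R v))) = (\<lambda>r. f (p + r *\<^sub>R v)) ` range (\<lambda>r. r * c)"
    by (simp add: image_image)
  moreover have "range (\<lambda>r. r * c) = UNIV"
    using assms by (intro surjI[of _ "\<lambda>r. r / c"]) simp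
  ultimately show ?thesis by simp
qed

lemmas range_rescale = image_range_rescale[where f = "\<lambda>x. x"]

text \<open>The direction \<open>w\<close> is chosen after the base point \<open>p\<close>: images
  are whole lines, but parallel lines are not assumed to have parallel images.\<close>

definition line_dir :: "('a::real_vector \<Rightarrow> 'a) \<Rightarrow> 'a \<Rightarrow> bool" where
  "line_dir f d \<longleftrightarrow>
     (\<forall>p. \<exists>w. w \<noteq> 0 \<and> range (\<lambda>r. f (p + r *\<^sub>R d)) = range (\<lambda>r. f p + r *\<^sub>R w))"

text \<open>Stated with coefficients because independence of the set \<open>{x, y}\<close> would say
  too little when \<open>x = y\<close>.\<close>

definition indep2 :: "'a::real_vector \<Rightarrow> 'a \<Rightarrow> bool" where
  "indep2 x y \<longleftrightarrow> (\<forall>a b. a *\<^sub>R x + b *\<^sub>R y = 0 \<longrightarrow> a = 0 \<and> b = 0)"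

lemma indep2_sym: "indep2 x y \<Longrightarrow> indep2 y x"
  unfolding indep2_def by (metis add.commute)

lemma indep2D:
  assumes "indep2 x y" "a *\<^sub>R x + b *\<^sub>R y = c *\<^sub>R x + d *\<^sub>R y"
  shows "a = c \<and> b = d"
proof -
  have "(a - c) *\<^sub>R x + (b - d) *\<^sub>R y = 0"
    using assms(2) by (simp add: scaleR_left_diff_distrib algebra_simps)
  then show ?thesis using assms(1) unfolding indep2_def by fastforce
qed

lemma line_dir_scale:
  assumes "line_dir f d" "c \<noteq> 0" shows "line_dir f (c *\<^sub>R d)"
  using assms(1) unfolding line_dir_def image_range_rescale[OF assms(2)] .

lemma line_dir_shift:
  assumes "line_dir f d" shows "line_dir (\<lambda>x. f (p + x) - f p) d"
  unfolding line_dir_def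
proof
  fix q
  obtain w where w: "w \<noteq> 0" "range (\<lambda>r. f (p + q + r *\<^sub>R d)) = range (\<lambda>r. f (p + q) + r *\<^sub>R w)"
    using assms unfolding line_dir_def by metis
  have "range (\<lambda>r. f (p + (q + r *\<^sub>R d)) - f p) = (\<lambda>y. y - f p) ` range (\<lambda>r. f (p + q + r *\<^sub>R d))"
    by (simp add: image_image add.assoc)
  also have "\<dots> = range (\<lambda>r. f (p + q) - f p + r *\<^sub>R w)"
    unfolding w(2) by (simp add: image_image algebra_simps)
  finally show "\<exists>w. w \<noteq> 0 \<and> range (\<lambda>r. f (p + (q + r *\<^sub>R d)) - f p)
      = range (\<lambda>r. f (p + q) - f p + r *\<^sub>R w)" using w(1) by blast
qed

lemma line_dir_point:
  assumes "range (\<lambda>r. f (p + r *\<^sub>R d)) = range (\<lambda>r. q + r *\<^sub>R (w::'a::real_vector))"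
  shows "\<exists>s. f (p + r *\<^sub>R d) = q + s *\<^sub>R w" "\<exists>s. q + r *\<^sub>R w = f (p + s *\<^sub>R d)"
proof -
  have "f (p + r *\<^sub>R d) \<in> range (\<lambda>r. q + r *\<^sub>R w)" unfolding assms[symmetric] by (rule rangeI)
  then show "\<exists>s. f (p + r *\<^sub>R d) = q + s *\<^sub>R w" by blast
  have "q + r *\<^sub>R w \<in> range (\<lambda>r. f (p + r *\<^sub>R d))" unfolding assms by (rule rangeI)
  then show "\<exists>s. q + r *\<^sub>R w = f (p + s *\<^sub>R d)" by blast
qed

text \<open>The image line meets the subspace in two points, distinct by injectivity, and so lies in
  it; \<open>g q\<close> is a point of this line.\<close>

lemma line_in_span:
  fixes g :: "'a::real_vector \<Rightarrow> 'a"
  assumes ld: "line_dir g d" and S: "subspace S" and inj: "inj g" and d: "d \<noteq> 0"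
    and ab: "a \<noteq> b" "g (q + a *\<^sub>R d) \<in> S" "g (q + b *\<^sub>R d) \<in> S"
  shows "g q \<in> S"
proof -
  obtain w where w: "w \<noteq> 0" "range (\<lambda>r. g (q + r *\<^sub>R d)) = range (\<lambda>r. g q + r *\<^sub>R w)"
    using ld unfolding line_dir_def by metis
  obtain s where s: "g (q + a *\<^sub>R d) = g q + s *\<^sub>R w" using line_dir_point(1)[OF w(2)] by blast
  obtain t where t: "g (q + b *\<^sub>R d) = g q + t *\<^sub>R w" using line_dir_point(1)[OF w(2)] by blast
  have "s \<noteq> t"
  proof
    assume "s = t"
    then have "q + a *\<^sub>R d = q + b *\<^sub>R d" using s t inj by (metis injD)
    then show False using ab d by simp
  qed
  have "(s - t) *\<^sub>R w \<in> S"
    using subspace_diff[OF S ab(2,3)] s t by (simp add: scaleR_left_diff_distrib)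
  then have "inverse (s - t) *\<^sub>R ((s - t) *\<^sub>R w) \<in> S" by (rule subspace_scale[OF S])
  then have "w \<in> S" using \<open>s \<noteq> t\<close> by simp
  then have "g q + s *\<^sub>R w - s *\<^sub>R w \<in> S" using ab(2) s S by (metis subspace_diff subspace_scale)
  then show ?thesis by simp
qed

section \<open>Images of planes\<close>

lemma span2_iff: "z \<in> span {x, y} \<longleftrightarrow> (\<exists>a b. z = a *\<^sub>R x + b *\<^sub>R (y::'a::real_vector))"
proof -
  have "z \<in> span {x, y} \<longleftrightarrow> (\<exists>a. z - a *\<^sub>R x \<in> span {y})" by (rule span_breakdown_eq)
  also have "\<dots> \<longleftrightarrow> (\<exists>a b. z - a *\<^sub>R x = b *\<^sub>R y)" by (simp add: span_singleton image_iff)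
  also have "\<dots> \<longleftrightarrow> (\<exists>a b. z = a *\<^sub>R x + b *\<^sub>R y)" by (simp add: algebra_simps)
  finally show ?thesis .
qed

text \<open>A nonzero common point of the two image lines would come from a common point of the
  axes, by injectivity.\<close>

lemma image_indep2:
  assumes inj: "inj g" and g0: "g 0 = 0" and ind: "indep2 d1 d2"
    and w1: "w1 \<noteq> 0" "range (\<lambda>r. g (r *\<^sub>R d1)) = range (\<lambda>r. r *\<^sub>R (w1::'a::real_vector))"
    and w2: "w2 \<noteq> 0" "range (\<lambda>r. g (r *\<^sub>R d2)) = range (\<lambda>r. r *\<^sub>R w2)"
  shows "indep2 w1 w2"
  unfolding indep2_def
proof (intro allI impI)
  fix a b assume ab: "a *\<^sub>R w1 + b *\<^sub>R w2 = 0"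
  obtain s where s: "a *\<^sub>R w1 = g (s *\<^sub>R d1)"
    using line_dir_point(2)[of g 0 d1 0 w1 a] w1(2) by auto
  obtain t where t: "(-b) *\<^sub>R w2 = g (t *\<^sub>R d2)"
    using line_dir_point(2)[of g 0 d2 0 w2 "-b"] w2(2) by auto
  have "a *\<^sub>R w1 = (-b) *\<^sub>R w2" using ab by (simp add: eq_neg_iff_add_eq_0)
  then have "s *\<^sub>R d1 = t *\<^sub>R d2" using s t inj by (metis injD)
  then have "s *\<^sub>R d1 + (-t) *\<^sub>R d2 = 0" by simp
  then have "s = 0" using ind unfolding indep2_def by blast
  then have "a *\<^sub>R w1 = 0" using s g0 by simp
  then show "a = 0 \<and> b = 0" using ab w1(1) w2(1) by simp
qed

text \<open>A line of direction \<open>d1 + d2\<close> through a point off the diagonal meets the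
  two axes in different points, whose images lie in the span. A diagonal point is reached along
  \<open>d1\<close> from two points off the diagonal.\<close>

lemma plane_image:
  fixes g :: "'a::real_vector \<Rightarrow> 'a"
  assumes inj: "inj g" and g0: "g 0 = 0" and ind: "indep2 d1 d2"
    and ld: "line_dir g d1" "line_dir g d2" "line_dir g (d1 + d2)"
    and w1: "w1 \<noteq> 0" "range (\<lambda>r. g (r *\<^sub>R d1)) = range (\<lambda>r. r *\<^sub>R w1)"
    and w2: "w2 \<noteq> 0" "range (\<lambda>r. g (r *\<^sub>R d2)) = range (\<lambda>r. r *\<^sub>R w2)"
  shows "g (a *\<^sub>R d1 + b *\<^sub>R d2) \<in> span {w1, w2}"
proof -
  let ?S = "span {w1, w2}"
  have nz: "d1 \<noteq> 0" "d1 + d2 \<noteq> 0"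
    using ind[unfolded indep2_def, rule_format, of 1 0] ind[unfolded indep2_def, rule_format, of 1 1]
    by auto
  have p1: "g (r *\<^sub>R d1) \<in> ?S" for r
  proof -
    obtain s where "g (r *\<^sub>R d1) = s *\<^sub>R w1" using w1(2) by blast
    then show ?thesis by (simp add: span_mul span_base)
  qed
  have p2: "g (r *\<^sub>R d2) \<in> ?S" for r
  proof -
    obtain s where "g (r *\<^sub>R d2) = s *\<^sub>R w2" using w2(2) by blast
    then show ?thesis by (simp add: span_mul span_base)
  qed
  have off: "g (a *\<^sub>R d1 + b *\<^sub>R d2) \<in> ?S" if "a \<noteq> b" for a b
  proof (rule line_in_span[OF ld(3) subspace_span inj nz(2)])
    show "-b \<noteq> -a" using that by simp
    have "a *\<^sub>R d1 + b *\<^sub>R d2 + (-b) *\<^sub>R (d1 + d2) = (a - b) *\<^sub>R d1" by (simp add: algebra_simps)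
    then show "g (a *\<^sub>R d1 + b *\<^sub>R d2 + (-b) *\<^sub>R (d1 + d2)) \<in> ?S" by (metis p1)
    have "a *\<^sub>R d1 + b *\<^sub>R d2 + (-a) *\<^sub>R (d1 + d2) = (b - a) *\<^sub>R d2" by (simp add: algebra_simps)
    then show "g (a *\<^sub>R d1 + b *\<^sub>R d2 + (-a) *\<^sub>R (d1 + d2)) \<in> ?S" by (metis p2)
  qed
  show ?thesis
  proof (cases "a = b")
    case False then show ?thesis by (rule off)
  next
    case True
    show ?thesis
    proof (rule line_in_span[OF ld(1) subspace_span inj nz(1)])
      show "(1::real) \<noteq> 2" by simp
      have "a *\<^sub>R d1 + b *\<^sub>R d2 + r *\<^sub>R d1 = (a + r) *\<^sub>R d1 + b *\<^sub>R d2" for r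
        by (simp add: algebra_simps)
      moreover have "g ((a + 1) *\<^sub>R d1 + b *\<^sub>R d2) \<in> ?S" "g ((a + 2) *\<^sub>R d1 + b *\<^sub>R d2) \<in> ?S"
        using True by (auto intro!: off)
      ultimately show "g (a *\<^sub>R d1 + b *\<^sub>R d2 + 1 *\<^sub>R d1) \<in> ?S" "g (a *\<^sub>R d1 + b *\<^sub>R d2 + 2 *\<^sub>R d1) \<in> ?S"
        by metis+
    qed
  qed
qed

text \<open>Parallel lines of a plane stay disjoint and coplanar, hence parallel.\<close>

lemma plane_parallel:
  fixes g :: "'a::real_vector \<Rightarrow> 'a"
  assumes inj: "inj g" and g0: "g 0 = 0" and ind: "indep2 d1 d2"
    and ld: "line_dir g d1" "line_dir g d2" "line_dir g (d1 + d2)"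
    and w1: "w1 \<noteq> 0" "range (\<lambda>r. g (r *\<^sub>R d1)) = range (\<lambda>r. r *\<^sub>R w1)"
    and w2: "w2 \<noteq> 0" "range (\<lambda>r. g (r *\<^sub>R d2)) = range (\<lambda>r. r *\<^sub>R w2)"
  shows "\<exists>s. g (a *\<^sub>R d1 + b *\<^sub>R d2) = g (b *\<^sub>R d2) + s *\<^sub>R w1"
proof (cases "b = 0")
  case True
  then show ?thesis using line_dir_point(1)[of g 0 d1 0 w1 a] w1(2) g0 by auto
next
  case False
  obtain w where w: "w \<noteq> 0" "range (\<lambda>r. g (b *\<^sub>R d2 + r *\<^sub>R d1)) = range (\<lambda>r. g (b *\<^sub>R d2) + r *\<^sub>R w)"
    using ld(1) unfolding line_dir_def by metis
  obtain B where B: "g (b *\<^sub>R d2) = B *\<^sub>R w2"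
    using line_dir_point(1)[of g 0 d2 0 w2 b] w2(2) by auto
  obtain u where u: "g (b *\<^sub>R d2) + 1 *\<^sub>R w = g (b *\<^sub>R d2 + u *\<^sub>R d1)"
    using line_dir_point(2)[OF w(2)] by blast
  have "g (b *\<^sub>R d2 + u *\<^sub>R d1) \<in> span {w1, w2}"
    using plane_image[OF assms, of u b] by (simp add: add.commute)
  then obtain \<alpha> \<beta>' where "g (b *\<^sub>R d2 + u *\<^sub>R d1) = \<alpha> *\<^sub>R w1 + \<beta>' *\<^sub>R w2" by (auto simp: span2_iff)
  then have wab: "w = \<alpha> *\<^sub>R w1 + (\<beta>' - B) *\<^sub>R w2"
    using u B by (simp add: algebra_simps)
  have "\<beta>' - B = 0"
  proof (rule ccontr)
    assume nz: "\<beta>' - B \<noteq> 0"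
    \<comment> \<open>At this parameter the image line would lose its \<open>w2\<close> component
      and run into the image of the axis \<open>d1\<close>.\<close>
    let ?c = "- B / (\<beta>' - B)"
    have "g (b *\<^sub>R d2) + ?c *\<^sub>R w = (B + ?c * (\<beta>' - B)) *\<^sub>R w2 + (?c * \<alpha>) *\<^sub>R w1"
      unfolding B wab by (simp add: scaleR_right_distrib scaleR_left_distrib)
    also have "\<dots> = (?c * \<alpha>) *\<^sub>R w1" using nz by simp
    finally have 1: "g (b *\<^sub>R d2) + ?c *\<^sub>R w = (?c * \<alpha>) *\<^sub>R w1" .
    obtain s where s: "g (b *\<^sub>R d2) + ?c *\<^sub>R w = g (b *\<^sub>R d2 + s *\<^sub>R d1)"
      using line_dir_point(2)[OF w(2)] by blast
    obtain t where t: "(?c * \<alpha>) *\<^sub>R w1 = g (t *\<^sub>R d1)"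
      using line_dir_point(2)[of g 0 d1 0 w1 "?c * \<alpha>"] w1(2) by auto
    have "b *\<^sub>R d2 + s *\<^sub>R d1 = t *\<^sub>R d1" using 1 s t inj by (metis injD)
    then have "s *\<^sub>R d1 + b *\<^sub>R d2 = t *\<^sub>R d1 + 0 *\<^sub>R d2" by (simp add: add.commute)
    then show False using indep2D[OF ind] False by blast
  qed
  then have wa: "w = \<alpha> *\<^sub>R w1" using wab by simp
  obtain s where "g (b *\<^sub>R d2 + a *\<^sub>R d1) = g (b *\<^sub>R d2) + s *\<^sub>R w"
    using line_dir_point(1)[OF w(2)] by blast
  then show ?thesis unfolding wa by (metis add.commute scaleR_scaleR)
qed

text \<open>Parallelism to either axis fixes both coordinates of an image point, which gives
  additivity. That the diagonal also goes to a line makes the scales of the two axes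
  proportional.\<close>

lemma plane_additive_scale:
  fixes g :: "'a::real_vector \<Rightarrow> 'a"
  assumes inj: "inj g" and g0: "g 0 = 0" and ind: "indep2 d1 d2"
    and ld: "line_dir g d1" "line_dir g d2" "line_dir g (d1 + d2)"
  shows "g (a *\<^sub>R d1 + b *\<^sub>R d2) = g (a *\<^sub>R d1) + g (b *\<^sub>R d2)"
    and "\<exists>A. surj A \<and> (\<forall>r. g (r *\<^sub>R d1) = A r *\<^sub>R g d1 \<and> g (r *\<^sub>R d2) = A r *\<^sub>R g d2)"
proof -
  obtain w1 where w1: "w1 \<noteq> 0" "range (\<lambda>r. g (r *\<^sub>R d1)) = range (\<lambda>r. r *\<^sub>R w1)"
    using ld(1)[unfolded line_dir_def, rule_format, of 0] g0 by auto
  obtain w2 where w2: "w2 \<noteq> 0" "range (\<lambda>r. g (r *\<^sub>R d2)) = range (\<lambda>r. r *\<^sub>R w2)"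
    using ld(2)[unfolded line_dir_def, rule_format, of 0] g0 by auto
  obtain w3 where w3: "w3 \<noteq> 0" "range (\<lambda>r. g (r *\<^sub>R (d1 + d2))) = range (\<lambda>r. r *\<^sub>R w3)"
    using ld(3)[unfolded line_dir_def, rule_format, of 0] g0 by auto
  have indw: "indep2 w1 w2" by (rule image_indep2[OF inj g0 ind w1 w2])
  have "\<forall>r. \<exists>s. g (r *\<^sub>R d1) = s *\<^sub>R w1" using w1(2) by blast
  then obtain A where A: "\<And>r. g (r *\<^sub>R d1) = A r *\<^sub>R w1" by metis
  have "\<forall>r. \<exists>s. g (r *\<^sub>R d2) = s *\<^sub>R w2" using w2(2) by blast
  then obtain B where B: "\<And>r. g (r *\<^sub>R d2) = B r *\<^sub>R w2" by metis
  have "\<forall>r. \<exists>s. g (r *\<^sub>R (d1 + d2)) = s *\<^sub>R w3" using w3(2) by blast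
  then obtain C where C: "\<And>r. g (r *\<^sub>R (d1 + d2)) = C r *\<^sub>R w3" by metis
  have add: "g (a *\<^sub>R d1 + b *\<^sub>R d2) = A a *\<^sub>R w1 + B b *\<^sub>R w2" for a b
  proof -
    obtain s where "g (a *\<^sub>R d1 + b *\<^sub>R d2) = g (b *\<^sub>R d2) + s *\<^sub>R w1"
      using plane_parallel[OF inj g0 ind ld w1 w2] by blast
    then have s: "g (a *\<^sub>R d1 + b *\<^sub>R d2) = s *\<^sub>R w1 + B b *\<^sub>R w2" using B by (simp add: add.commute)
    have ld': "line_dir g (d2 + d1)" using ld(3) by (simp add: add.commute)
    obtain t where "g (b *\<^sub>R d2 + a *\<^sub>R d1) = g (a *\<^sub>R d1) + t *\<^sub>R w2"
      using plane_parallel[OF inj g0 indep2_sym[OF ind] ld(2,1) ld' w2 w1] by blast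
    then have "g (a *\<^sub>R d1 + b *\<^sub>R d2) = A a *\<^sub>R w1 + t *\<^sub>R w2" using A by (simp add: add.commute)
    then show ?thesis using s indep2D[OF indw] by metis
  qed
  show "g (a *\<^sub>R d1 + b *\<^sub>R d2) = g (a *\<^sub>R d1) + g (b *\<^sub>R d2)" using add A B by metis
  have nz: "A 1 \<noteq> 0" "B 1 \<noteq> 0"
  proof -
    have "d1 \<noteq> 0" "d2 \<noteq> 0"
      using ind[unfolded indep2_def, rule_format, of 1 0] ind[unfolded indep2_def, rule_format, of 0 1] by auto
    then have "g d1 \<noteq> 0" "g d2 \<noteq> 0" using inj g0 by (metis injD)+
    then show "A 1 \<noteq> 0" "B 1 \<noteq> 0" using A[of 1] B[of 1] by auto
  qed
  have "A r *\<^sub>R w1 + B r *\<^sub>R w2 = C r *\<^sub>R w3" for r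
    using add[of r r] C[of r] by (simp add: scaleR_right_distrib)
  then have e: "A r *\<^sub>R w1 + B r *\<^sub>R w2 = C r *\<^sub>R w3" for r by blast
  \<comment> \<open>Eliminates \<open>w3\<close> between the equations for \<open>r\<close> and for
    \<open>1\<close>.\<close>
  have "(C 1 * A r) *\<^sub>R w1 + (C 1 * B r) *\<^sub>R w2 = (C r * A 1) *\<^sub>R w1 + (C r * B 1) *\<^sub>R w2" for r
    using arg_cong[OF e[of r], of "\<lambda>z. C 1 *\<^sub>R z"] arg_cong[OF e[of 1], of "\<lambda>z. C r *\<^sub>R z"]
    by (simp add: scaleR_right_distrib mult.commute)
  then have q: "C 1 * A r = C r * A 1 \<and> C 1 * B r = C r * B 1" for r
    using indep2D[OF indw] by blast
  have c1: "C 1 \<noteq> 0"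
  proof
    assume "C 1 = 0"
    then have "A 1 *\<^sub>R w1 + B 1 *\<^sub>R w2 = 0" using e[of 1] by simp
    then show False using indw nz unfolding indep2_def by blast
  qed
  have r: "A r = C r / C 1 * A 1" "B r = C r / C 1 * B 1" for r
    using q[of r] c1 by (simp_all add: field_simps)
  have "surj (\<lambda>r. C r / C 1)"
    unfolding surj_def
  proof
    fix y
    obtain s where "(y * C 1) *\<^sub>R w3 = g (s *\<^sub>R (d1 + d2))"
      using line_dir_point(2)[of g 0 "d1 + d2" 0 w3 "y * C 1"] w3(2) by auto
    then have "y * C 1 = C s" using C w3(1) by simp
    then show "\<exists>x. y = C x / C 1" using c1 by (metis nonzero_eq_divide_eq)
  qed
  moreover have "g (r *\<^sub>R d1) = (C r / C 1) *\<^sub>R g d1" "g (r *\<^sub>R d2) = (C r / C 1) *\<^sub>R g d2" for r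
    using A[of r] A[of 1] B[of r] B[of 1] r[of r] by simp_all
  ultimately show "\<exists>A. surj A \<and> (\<forall>r. g (r *\<^sub>R d1) = A r *\<^sub>R g d1 \<and> g (r *\<^sub>R d2) = A r *\<^sub>R g d2)"
    by blast
qed


section \<open>Vanishing of mixed second differences\<close>

definition trans_inv :: "('a::real_vector \<Rightarrow> 'a) \<Rightarrow> 'a \<Rightarrow> 'a \<Rightarrow> bool" where
  "trans_inv f x y \<longleftrightarrow> (\<forall>p. f (p + y + x) - f (p + y) = f (p + x) - f p)"

lemma trans_inv_sym: "trans_inv f x y \<Longrightarrow> trans_inv f y x"
  unfolding trans_inv_def by (simp add: algebra_simps)

text \<open>Together with symmetry this makes the relation additive in both arguments, so it can be
  assembled from time and space parts.\<close>

lemma trans_inv_add: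
  assumes "trans_inv f x y" "trans_inv f x y'" shows "trans_inv f x (y + y')"
  unfolding trans_inv_def
proof
  fix p
  have "f (p + y + y' + x) - f (p + y + y') = f (p + y + x) - f (p + y)"
    "f (p + y + x) - f (p + y) = f (p + x) - f p"
    using assms unfolding trans_inv_def by blast+
  then show "f (p + (y + y') + x) - f (p + (y + y')) = f (p + x) - f p" by (simp add: add.assoc)
qed

lemma trans_inv_zero: "trans_inv f x 0" "trans_inv f 0 x"
  unfolding trans_inv_def by simp_all

lemma plane_scale:
  fixes f :: "'a::real_vector \<Rightarrow> 'a"
  assumes inj: "inj f" and ind: "indep2 d1 d2"
    and ld: "line_dir f d1" "line_dir f d2" "line_dir f (d1 + d2)"
  shows "\<exists>A. surj A \<and> (\<forall>r. f (p + r *\<^sub>R d1) - f p = A r *\<^sub>R (f (p + d1) - f p)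
                          \<and> f (p + r *\<^sub>R d2) - f p = A r *\<^sub>R (f (p + d2) - f p))"
proof -
  have "inj (\<lambda>x. f (p + x) - f p)" by (rule injI) (auto dest: injD[OF inj])
  from plane_additive_scale(2)[OF this _ ind line_dir_shift[OF ld(1)] line_dir_shift[OF ld(2)] line_dir_shift[OF ld(3)]]
  show ?thesis by simp
qed

lemma plane_trans:
  fixes f :: "'a::real_vector \<Rightarrow> 'a"
  assumes inj: "inj f" and ind: "indep2 d1 d2"
    and ld: "line_dir f d1" "line_dir f d2" "line_dir f (d1 + d2)"
  shows "trans_inv f (a *\<^sub>R d1) (b *\<^sub>R d2)"
  unfolding trans_inv_def
proof
  fix p
  have "inj (\<lambda>x. f (p + x) - f p)" by (rule injI) (auto dest: injD[OF inj])
  from plane_additive_scale(1)[OF this _ ind line_dir_shift[OF ld(1)] line_dir_shift[OF ld(2)] line_dir_shift[OF ld(3)], of a b]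
  show "f (p + b *\<^sub>R d2 + a *\<^sub>R d1) - f (p + b *\<^sub>R d2) = f (p + a *\<^sub>R d1) - f p"
    by (simp add: algebra_simps)
qed

text \<open>Two steps along one direction span no plane, so \<open>b *\<^sub>R d1\<close> is written
  as \<open>b *\<^sub>R (d1 + d2) - b *\<^sub>R d2\<close>. The pair \<open>- d1\<close>,
  \<open>d1 + d2\<close> is admissible because its sum is \<open>d2\<close>.\<close>

lemma plane_trans_self:
  fixes f :: "'a::real_vector \<Rightarrow> 'a"
  assumes inj: "inj f" and ind: "indep2 d1 d2"
    and ld: "line_dir f d1" "line_dir f d2" "line_dir f (d1 + d2)"
  shows "trans_inv f (a *\<^sub>R d1) (b *\<^sub>R d1)"
proof -
  have "indep2 (- d1) (d1 + d2)"
    unfolding indep2_def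
  proof (intro allI impI)
    fix a b assume "a *\<^sub>R (- d1) + b *\<^sub>R (d1 + d2) = 0"
    then have "(b - a) *\<^sub>R d1 + b *\<^sub>R d2 = 0" by (simp add: algebra_simps)
    then have "b - a = 0 \<and> b = 0" using ind unfolding indep2_def by blast
    then show "a = 0 \<and> b = 0" by simp
  qed
  moreover have "line_dir f (- d1)" using line_dir_scale[OF ld(1), of "-1"] by simp
  ultimately have "trans_inv f ((-a) *\<^sub>R (- d1)) (b *\<^sub>R (d1 + d2))"
    using plane_trans[OF inj, of "- d1" "d1 + d2" "-a" b] ld by simp
  then have 1: "trans_inv f (a *\<^sub>R d1) (b *\<^sub>R (d1 + d2))" by simp
  have "trans_inv f (a *\<^sub>R d1) ((-b) *\<^sub>R d2)" by (rule plane_trans[OF assms])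
  from trans_inv_add[OF 1 this] show ?thesis by (simp add: algebra_simps)
qed

text \<open>Additivity and the common scale \<open>A\<close> put the image on a line, and
  surjectivity of \<open>A\<close> makes it fill the line, although \<open>A\<close> is not yet
  known to be the identity.\<close>

lemma line_dir_diff:
  fixes f :: "'a::real_vector \<Rightarrow> 'a"
  assumes inj: "inj f" and ind: "indep2 d1 d2"
    and ld: "line_dir f d1" "line_dir f d2" "line_dir f (d1 + d2)"
  shows "line_dir f (d1 - d2)"
  unfolding line_dir_def
proof
  fix p
  obtain A where A: "surj A" "\<And>r. f (p + r *\<^sub>R d1) - f p = A r *\<^sub>R (f (p + d1) - f p)"
      "\<And>r. f (p + r *\<^sub>R d2) - f p = A r *\<^sub>R (f (p + d2) - f p)"
    using plane_scale[OF assms] by blast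
  have ld': "line_dir f (d2 + d1)" using ld(3) by (simp add: add.commute)
  let ?w = "f (p + d1) - f (p + d2)"
  have eq: "f (p + r *\<^sub>R (d1 - d2)) = f p + A r *\<^sub>R ?w" for r
  proof -
    have "f (p + (-r) *\<^sub>R d2 + r *\<^sub>R d1) - f (p + (-r) *\<^sub>R d2) = f (p + r *\<^sub>R d1) - f p"
      using plane_trans[OF assms, of r "-r"] unfolding trans_inv_def by blast
    moreover have "f (p + (-r) *\<^sub>R d2 + r *\<^sub>R d2) - f (p + (-r) *\<^sub>R d2) = f (p + r *\<^sub>R d2) - f p"
      using plane_trans_self[OF inj indep2_sym[OF ind] ld(2,1) ld', of r "-r"] unfolding trans_inv_def by blast
    ultimately have m: "f (p + r *\<^sub>R (d1 - d2)) = f (p + (-r) *\<^sub>R d2) + (f (p + r *\<^sub>R d1) - f p)"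
      "f (p + (-r) *\<^sub>R d2) = f p - (f (p + r *\<^sub>R d2) - f p)"
      by (simp_all add: algebra_simps)
    have "f (p + r *\<^sub>R (d1 - d2)) = f p + (f (p + r *\<^sub>R d1) - f p) - (f (p + r *\<^sub>R d2) - f p)"
      unfolding m by simp
    also have "\<dots> = f p + A r *\<^sub>R ?w" unfolding A(2)[of r] A(3)[of r] by (simp add: algebra_simps)
    finally show ?thesis .
  qed
  have "d1 \<noteq> d2" using ind[unfolded indep2_def, rule_format, of 1 "-1"] by auto
  then have "?w \<noteq> 0" using inj_eq[OF inj] by simp
  moreover have "range (\<lambda>r. f (p + r *\<^sub>R (d1 - d2))) = (\<lambda>r. f p + r *\<^sub>R ?w) ` range A"
    unfolding eq by (simp add: image_image)
  ultimately show "\<exists>w. w \<noteq> 0 \<and> range (\<lambda>r. f (p + r *\<^sub>R (d1 - d2))) = range (\<lambda>r. f p + r *\<^sub>R w)"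
    unfolding A(1) by blast
qed

text \<open>Such a map fixes the rationals and, taking squares to squares, preserves the order;
  density of the rationals leaves only the identity.\<close>

lemma real_ring_endo_id:
  fixes A :: "real \<Rightarrow> real"
  assumes add: "\<And>x y. A (x + y) = A x + A y" and mult: "\<And>x y. A (x * y) = A x * A y" and one: "A 1 = 1"
  shows "A x = x"
proof -
  have z: "A 0 = 0" using add[of 0 0] by simp
  have neg: "A (- x) = - A x" for x using add[of x "-x"] z by simp
  have nat: "A (of_nat n) = of_nat n" for n by (induction n) (simp_all add: z add one)
  have int: "A (of_int k) = of_int k" for k
    by (cases k rule: int_cases2) (simp_all add: nat neg)
  have rat: "A q = q" if "q \<in> \<rat>" for q
  proof -
    have "\<exists>a b. b > 0 \<and> q = of_int a / of_int b" using that by (cases q rule: Rats_cases') auto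
    then obtain a b where ab: "b > 0" "q = of_int a / of_int b" by blast
    then have "q * of_int b = of_int a" by simp
    then have "A q * of_int b = q * of_int b" by (metis int mult)
    then show ?thesis using ab(1) by simp
  qed
  have pos: "A x \<ge> 0" if "x \<ge> 0" for x
  proof -
    have "A x = A (sqrt x) * A (sqrt x)" using that mult[of "sqrt x" "sqrt x"] by simp
    then show ?thesis by simp
  qed
  have mono: "A x \<le> A y" if "x \<le> y" for x y
    using pos[of "y - x"] add[of y "-x"] neg[of x] that by simp
  show ?thesis
  proof (rule ccontr)
    assume "A x \<noteq> x"
    then consider "A x < x" | "x < A x" by linarith
    then show False
    proof cases
      case 1
      then obtain q where "q \<in> \<rat>" "A x < q" "q < x" using Rats_dense_in_real by blast
      then show False using mono[of q x] rat by simp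
    next
      case 2
      then obtain q where "q \<in> \<rat>" "x < q" "q < A x" using Rats_dense_in_real by blast
      then show False using mono[of x q] rat by simp
    qed
  qed
qed

section \<open>Orthogonal directions, and affinity from a cone of directions\<close>

lemma obtain_orthogonal:
  fixes e x :: "'a::euclidean_space"
  assumes "3 \<le> DIM('a)"
  obtains u where "u \<bullet> u = 1" "u \<bullet> e = 0" "u \<bullet> x = 0"
proof -
  have "dim {e, x} \<le> card {e, x}" by (rule dim_le_card') simp
  also have "\<dots> \<le> 2" by (simp add: card_insert_if)
  finally have "dim {e, x} < DIM('a)" using assms by simp
  then obtain y where y: "y \<noteq> 0" "\<And>z. z \<in> span {e, x} \<Longrightarrow> orthogonal y z"
    using orthogonal_to_subspace_exists by blast
  have "y \<bullet> e = 0" "y \<bullet> x = 0" using y(2)[of e] y(2)[of x] by (simp_all add: span_base orthogonal_def)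
  moreover have "(y /\<^sub>R norm y) \<bullet> (y /\<^sub>R norm y) = 1"
    using y(1) by (simp add: dot_square_norm power2_eq_square)
  ultimately show thesis using that[of "y /\<^sub>R norm y"] by simp
qed

lemma indep2_orthogonal:
  fixes x y :: "'a::real_inner"
  assumes "x \<bullet> y = 0" "x \<noteq> 0" "y \<noteq> 0" shows "indep2 x y"
  unfolding indep2_def
proof (intro allI impI)
  fix a b assume z: "a *\<^sub>R x + b *\<^sub>R y = 0"
  have "(a *\<^sub>R x + b *\<^sub>R y) \<bullet> x = a * (x \<bullet> x)" "(a *\<^sub>R x + b *\<^sub>R y) \<bullet> y = b * (y \<bullet> y)"
    using assms(1) by (simp_all add: inner_add_left inner_commute[of y x])
  then show "a = 0 \<and> b = 0" using assms z by simp
qed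

text \<open>
  The vertical line and two opposite lines of speed \<open>v\<close> are three directions in one plane, so
  \<open>line_dir_diff\<close> adds the spatial direction to them.  The spatial directions then form a space in
  which every direction is available.
\<close>

lemma cone_affine:
  fixes f :: "'a::euclidean_space \<Rightarrow> 'a"
  assumes dim: "3 \<le> DIM('a)" and e: "e \<bullet> e = 1" and v: "v > 0" and inj: "inj f"
    and lde: "line_dir f e"
    and ldu: "\<And>u. u \<bullet> u = 1 \<Longrightarrow> u \<bullet> e = 0 \<Longrightarrow> line_dir f (e + v *\<^sub>R u)"
  shows "linear (\<lambda>x. f x - f 0)"
proof -
  have e0: "e \<noteq> 0" using e by auto
  have unit: "line_dir f u" if u: "u \<bullet> u = 1" "u \<bullet> e = 0" for u
  proof -
    have "indep2 (e + v *\<^sub>R u) (e + v *\<^sub>R (-u))"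
      unfolding indep2_def
    proof (intro allI impI)
      fix a b assume "a *\<^sub>R (e + v *\<^sub>R u) + b *\<^sub>R (e + v *\<^sub>R (-u)) = 0"
      then have "(a + b) *\<^sub>R e + ((a - b) * v) *\<^sub>R u = 0" by (simp add: algebra_simps)
      moreover have "indep2 e u" using u e e0 by (intro indep2_orthogonal) (auto simp: inner_commute)
      ultimately have "a + b = 0 \<and> (a - b) * v = 0" unfolding indep2_def by blast
      then show "a = 0 \<and> b = 0" using v by auto
    qed
    moreover have "line_dir f (e + v *\<^sub>R u)" "line_dir f (e + v *\<^sub>R (-u))"
      using u by (intro ldu; simp)+
    moreover have "line_dir f (e + v *\<^sub>R u + (e + v *\<^sub>R (-u)))"
      using line_dir_scale[OF lde, of 2] by (simp add: scaleR_2)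
    ultimately have "line_dir f (e + v *\<^sub>R u - (e + v *\<^sub>R (-u)))" by (intro line_dir_diff[OF inj])
    then have "line_dir f ((2 * v) *\<^sub>R u)" by (simp add: algebra_simps scaleR_2 flip: scaleR_scaleR)
    from line_dir_scale[OF this, of "1 / (2 * v)"] show ?thesis using v by simp
  qed
  have normalise: "(u /\<^sub>R norm u) \<bullet> (u /\<^sub>R norm u) = 1" "(u /\<^sub>R norm u) \<bullet> e = 0"
    if "u \<noteq> 0" "u \<bullet> e = 0" for u
    using that by (simp_all add: dot_square_norm power2_eq_square)
  have spatial: "line_dir f u" if "u \<noteq> 0" "u \<bullet> e = 0" for u
    using line_dir_scale[OF unit[OF normalise[OF that]], of "norm u"] that by simp
  have indu: "line_dir f (u + u')" if "indep2 u u'" "u \<bullet> e = 0" "u' \<bullet> e = 0" for u u'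
  proof (rule spatial)
    show "u + u' \<noteq> 0" using that(1)[unfolded indep2_def, rule_format, of 1 1] by auto
    show "(u + u') \<bullet> e = 0" using that by (simp add: inner_add_left)
  qed
  \<comment> \<open>The factor \<open>c\<close> gives the spatial vector the length
    \<open>v\<close>, so that its sum with \<open>e\<close> lies on the cone.\<close>
  have plane: "indep2 e (c *\<^sub>R u) \<and> line_dir f (c *\<^sub>R u) \<and> line_dir f (e + c *\<^sub>R u)"
    if "u \<noteq> 0" "u \<bullet> e = 0" "c = v / norm u" for u c
  proof (intro conjI)
    show "indep2 e (c *\<^sub>R u)" using that v e0 by (intro indep2_orthogonal) (simp_all add: inner_commute)
    show "line_dir f (c *\<^sub>R u)" using that v by (intro spatial) simp_all
    show "line_dir f (e + c *\<^sub>R u)"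
      using ldu[OF normalise[OF that(1,2)]] that(3) by (simp add: divide_inverse)
  qed
  have tee: "trans_inv f (a *\<^sub>R e) (b *\<^sub>R e)" for a b
  proof -
    obtain u where "u \<bullet> u = 1" "u \<bullet> e = 0" using obtain_orthogonal[OF dim] by metis
    then have "u \<noteq> 0" "u \<bullet> e = 0" by auto
    then show ?thesis using plane_trans_self[OF inj _ lde] plane by blast
  qed
  have teu: "trans_inv f (a *\<^sub>R e) u" if "u \<bullet> e = 0" for a u
  proof (cases "u = 0")
    case False
    have "trans_inv f (a *\<^sub>R e) ((norm u / v) *\<^sub>R (v / norm u) *\<^sub>R u)"
      using plane_trans[OF inj _ lde] plane[OF False that] by blast
    then show ?thesis using v False by simp
  qed (simp add: trans_inv_zero)
  have nonzero: "u \<noteq> 0 \<and> u' \<noteq> 0" if "indep2 u u'" for u u'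
    using that[unfolded indep2_def, rule_format, of 1 0] that[unfolded indep2_def, rule_format, of 0 1] by auto
  have tuu: "trans_inv f u u'" if ue: "u \<bullet> e = 0" "u' \<bullet> e = 0" for u u'
  proof (cases "indep2 u u'")
    case True
    then have "line_dir f u" "line_dir f u'" "line_dir f (u + u')"
      using spatial nonzero indu ue by blast+
    from plane_trans[OF inj True this, of 1 1] show ?thesis by simp
  next
    case False
    show ?thesis
    proof (cases "u = 0")
      case u0: False
      obtain a b where ab: "a *\<^sub>R u + b *\<^sub>R u' = 0" "a \<noteq> 0 \<or> b \<noteq> 0"
        using False unfolding indep2_def by blast
      have "b \<noteq> 0" using ab u0 by auto
      have "b *\<^sub>R u' = (- a) *\<^sub>R u" using ab(1) by (simp add: eq_neg_iff_add_eq_0 add.commute)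
      then have "(1 / b) *\<^sub>R (b *\<^sub>R u') = (1 / b) *\<^sub>R ((- a) *\<^sub>R u)" by simp
      then have "u' = (- a / b) *\<^sub>R u" using \<open>b \<noteq> 0\<close> by simp
      \<comment> \<open>A second spatial direction, so that \<open>u\<close> lies in a plane to
        which \<open>plane_trans_self\<close> applies.\<close>
      moreover obtain u1 where u1: "u1 \<bullet> u1 = 1" "u1 \<bullet> e = 0" "u1 \<bullet> u = 0"
        using obtain_orthogonal[OF dim] by metis
      have ind: "indep2 u u1" using u1 u0 by (intro indep2_orthogonal) (auto simp: inner_commute)
      have "trans_inv f (1 *\<^sub>R u) ((- a / b) *\<^sub>R u)"
        using plane_trans_self[OF inj ind spatial spatial indu[OF ind]] nonzero[OF ind] ue u1 by blast
      ultimately show ?thesis by simp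
    qed (simp add: trans_inv_zero)
  qed
  define F where "F x = f x - f 0" for x
  have trans: "trans_inv f x y" for x y
  proof -
    define x' y' where "x' = x - (x \<bullet> e) *\<^sub>R e" and "y' = y - (y \<bullet> e) *\<^sub>R e"
    have o: "x' \<bullet> e = 0" "y' \<bullet> e = 0" unfolding x'_def y'_def using e by (simp_all add: inner_diff_left)
    have "trans_inv f x' ((y \<bullet> e) *\<^sub>R e + y')" "trans_inv f ((x \<bullet> e) *\<^sub>R e) ((y \<bullet> e) *\<^sub>R e + y')"
      using tee teu tuu o trans_inv_add trans_inv_sym by blast+
    then have "trans_inv f y x'" "trans_inv f y ((x \<bullet> e) *\<^sub>R e)"
      using trans_inv_sym by (simp_all add: y'_def)
    from trans_inv_add[OF this] show ?thesis using trans_inv_sym by (simp add: x'_def)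
  qed
  have Fadd: "F (x + y) = F x + F y" for x y
    using trans[of y x, unfolded trans_inv_def, rule_format, of 0] unfolding F_def
    by (simp add: algebra_simps)
  have F0: "F 0 = 0" by (simp add: F_def)
  have Finj: "F x \<noteq> 0" if "x \<noteq> 0" for x using inj_eq[OF inj] that by (simp add: F_def)
  have common: "\<exists>A. (\<forall>r. F (r *\<^sub>R d1) = A r *\<^sub>R F d1) \<and> (\<forall>r. F (r *\<^sub>R d2) = A r *\<^sub>R F d2)"
    if "indep2 d1 d2" "line_dir f d1" "line_dir f d2" "line_dir f (d1 + d2)" for d1 d2
    using plane_scale[OF inj that, of 0] unfolding F_def by auto
  \<comment> \<open>The two directions of a plane share their scale function, so one function
    spreads from plane to plane to all directions.\<close>
  have transfer: "\<forall>r. F (r *\<^sub>R d2) = A r *\<^sub>R F d2"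
    if i: "indep2 d1 d2" and l: "line_dir f d1" "line_dir f d2" "line_dir f (d1 + d2)"
      and A: "\<forall>r. F (r *\<^sub>R d1) = A r *\<^sub>R F d1" for d1 d2 A
  proof -
    obtain B where B: "\<forall>r. F (r *\<^sub>R d1) = B r *\<^sub>R F d1" "\<forall>r. F (r *\<^sub>R d2) = B r *\<^sub>R F d2"
      using common[OF i l] by blast
    have "F d1 \<noteq> 0" using Finj nonzero[OF i] by blast
    then have "B r = A r" for r using A B(1) by (metis scaleR_right_imp_eq)
    then show ?thesis using B(2) by simp
  qed
  obtain u0 where u0: "u0 \<bullet> u0 = 1" "u0 \<bullet> e = 0" using obtain_orthogonal[OF dim] by metis
  \<comment> \<open>A second reference direction, for the vectors that are dependent on
    \<open>u0\<close>.\<close>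
  obtain u1 where u1: "u1 \<bullet> u1 = 1" "u1 \<bullet> e = 0" "u1 \<bullet> u0 = 0" using obtain_orthogonal[OF dim] by metis
  have u01: "u0 \<noteq> 0" "u1 \<noteq> 0" using u0 u1 by auto
  have ind: "indep2 u0 u1" using u01 u1 by (intro indep2_orthogonal) (simp_all add: inner_commute)
  obtain A where A: "\<forall>r. F (r *\<^sub>R u0) = A r *\<^sub>R F u0"
    using common[OF ind spatial spatial indu[OF ind]] u01 u0 u1 by blast
  have A1: "\<forall>r. F (r *\<^sub>R u1) = A r *\<^sub>R F u1"
    using transfer[OF ind spatial spatial indu[OF ind] A] u01 u0 u1 by blast
  have Au: "F (r *\<^sub>R u) = A r *\<^sub>R F u" if ue: "u \<bullet> e = 0" for r u
  proof (cases "u = 0")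
    case False
    show ?thesis
    proof (cases "indep2 u0 u")
      case True
      then show ?thesis using transfer[OF True spatial spatial indu[OF True] A] u01 u0 ue False by blast
    next
      case dep: False
      obtain a b where ab: "a *\<^sub>R u0 + b *\<^sub>R u = 0" "a \<noteq> 0 \<or> b \<noteq> 0"
        using dep unfolding indep2_def by blast
      have "(a *\<^sub>R u0 + b *\<^sub>R u) \<bullet> u1 = b * (u \<bullet> u1)" using u1 by (simp add: inner_add_left inner_commute[of u0])
      moreover have "b \<noteq> 0" using ab u01 by auto
      ultimately have "u \<bullet> u1 = 0" using ab(1) by simp
      then have i: "indep2 u1 u" using False u01 by (intro indep2_orthogonal) (simp_all add: inner_commute)
      then show ?thesis using transfer[OF i spatial spatial indu[OF i] A1] u01 u1 ue False by blast
    qed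
  qed (simp add: F0)
  have Ae: "F (r *\<^sub>R e) = A r *\<^sub>R F e" for r
  proof -
    let ?d = "(v / norm u0) *\<^sub>R u0"
    have p: "indep2 e ?d" "line_dir f ?d" "line_dir f (e + ?d)" using plane[OF u01(1) u0(2)] by blast+
    then have q: "line_dir f (?d + e)" by (simp add: add.commute)
    have "\<forall>r. F (r *\<^sub>R ?d) = A r *\<^sub>R F ?d" using u0 by (intro allI Au) simp
    from transfer[OF indep2_sym[OF p(1)] p(2) lde q this] show ?thesis by (rule spec)
  qed
  have Fu0: "F u0 \<noteq> 0" by (rule Finj[OF u01(1)])
  have "A r = r" for r
  proof (rule real_ring_endo_id[of A])
    fix x y
    have "A (x + y) *\<^sub>R F u0 = (A x + A y) *\<^sub>R F u0"
      unfolding A[rule_format, symmetric] scaleR_left_distrib Fadd ..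
    then show "A (x + y) = A x + A y" using Fu0 by simp
    \<comment> \<open>Multiplicativity comes from scaling the vector \<open>y *\<^sub>R u0\<close>
      by \<open>x\<close>: its scale function is \<open>A\<close> as well.\<close>
    have "A (x * y) *\<^sub>R F u0 = (A x * A y) *\<^sub>R F u0"
      using A[rule_format, of "x * y"] A[rule_format, of y] Au[of "y *\<^sub>R u0" x] u0(2) by simp
    then show "A (x * y) = A x * A y" using Fu0 by simp
  next
    have "A 1 *\<^sub>R F u0 = 1 *\<^sub>R F u0" using A[rule_format, of 1] by simp
    then show "A 1 = 1" using Fu0 scaleR_right_imp_eq by blast
  qed
  note Ar = this
  have "F (r *\<^sub>R x) = r *\<^sub>R F x" for r x
  proof -
    obtain a x' where x: "x = a *\<^sub>R e + x'" and o: "x' \<bullet> e = 0"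
    proof
      show "x = (x \<bullet> e) *\<^sub>R e + (x - (x \<bullet> e) *\<^sub>R e)" by simp
      show "(x - (x \<bullet> e) *\<^sub>R e) \<bullet> e = 0" using e by (simp add: inner_diff_left)
    qed
    have "F (r *\<^sub>R x) = F ((r * a) *\<^sub>R e) + F (r *\<^sub>R x')"
      unfolding x scaleR_right_distrib Fadd by simp
    also have "\<dots> = (r * a) *\<^sub>R F e + r *\<^sub>R F x'" unfolding Ae Au[OF o] Ar ..
    also have "\<dots> = r *\<^sub>R (a *\<^sub>R F e + F x')" by (simp add: scaleR_right_distrib)
    also have "a *\<^sub>R F e + F x' = F x" unfolding x Fadd Ae Ar ..
    finally show ?thesis .
  qed
  then show ?thesis using Fadd unfolding F_def[abs_def] by (intro linearI)
qed

section \<open>Reflections, swaps and invariant forms\<close>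

text \<open>The vector \<open>d\<close> need not be normalised, and \<open>mirror 0\<close> is the
  identity.\<close>

definition mirror :: "'a::real_inner \<Rightarrow> 'a \<Rightarrow> 'a" where
  "mirror d w = w - (2 * (w \<bullet> d) / (d \<bullet> d)) *\<^sub>R d"

lemma mirror_orthogonal: "orthogonal_transformation (mirror d)"
  unfolding orthogonal_transformation_def
proof (intro conjI allI)
  show "linear (mirror d)"
    by (rule linearI) (simp_all add: mirror_def inner_add_left algebra_simps add_divide_distrib)
  show "mirror d v \<bullet> mirror d w = v \<bullet> w" for v w
  proof (cases "d = 0")
    case False
    then show ?thesis
      by (simp add: mirror_def inner_diff_left inner_diff_right inner_commute field_simps)
  qed (simp add: mirror_def)
qed

lemma mirror_fix: "w \<bullet> d = 0 \<Longrightarrow> mirror d w = w"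
  by (simp add: mirror_def)

lemma mirror_self: "mirror d d = - d"
  by (cases "d = 0") (simp_all add: mirror_def scaleR_2 algebra_simps)

lemma mirror_mirror: "mirror d (mirror d w) = w"
  by (cases "d = 0") (simp_all add: mirror_def inner_diff_left field_simps)

lemma mirror_swap: "x \<bullet> x = y \<bullet> y \<Longrightarrow> mirror (x - y) x = y"
proof (cases "x = y")
  case False
  assume "x \<bullet> x = y \<bullet> y"
  then have "2 * (x \<bullet> (x - y)) = (x - y) \<bullet> (x - y)"
    by (simp add: inner_diff_left inner_diff_right inner_commute)
  moreover have "(x - y) \<bullet> (x - y) \<noteq> 0" using False by simp
  ultimately have *: "2 * (x \<bullet> (x - y)) / ((x - y) \<bullet> (x - y)) = 1" by (metis divide_self)
  show ?thesis unfolding mirror_def * by simp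
qed (simp add: mirror_def)

text \<open>The reflection along \<open>x - y\<close> exchanges the two vectors, and it fixes
  \<open>e\<close> because \<open>x - y\<close> is orthogonal to \<open>e\<close>.\<close>

lemma isotropic:
  assumes "x \<bullet> e = y \<bullet> e" "x \<bullet> x = y \<bullet> y"
  obtains k where "orthogonal_transformation k" "k e = e" "k x = y"
proof
  show "orthogonal_transformation (mirror (x - y))" by (rule mirror_orthogonal)
  show "mirror (x - y) e = e"
    using assms by (intro mirror_fix) (simp add: inner_diff_right inner_commute)
  show "mirror (x - y) x = y" using assms(2) by (rule mirror_swap)
qed

lemma orthogonal_transformation_inner:
  "orthogonal_transformation k \<Longrightarrow> k v \<bullet> k w = v \<bullet> w"
  unfolding orthogonal_transformation_def by blast

text \<open>
  \<open>form\<close> is \<open>t t' - \<kappa> (s \<bullet> s')\<close> for the time components \<open>t, t'\<close> and the spatial parts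
  \<open>s, s'\<close> with respect to the unit vector \<open>e\<close>; \<open>speed_group\<close> is the Galilean group for \<open>\<kappa> = 0\<close>
  and the Lorentz group with \<open>c = 1 / sqrt \<kappa>\<close> for \<open>\<kappa> > 0\<close>, without reversal of time.
\<close>

definition form :: "'a::real_inner \<Rightarrow> real \<Rightarrow> 'a \<Rightarrow> 'a \<Rightarrow> real" where
  "form e \<kappa> p q = (1 + \<kappa>) * (p \<bullet> e) * (q \<bullet> e) - \<kappa> * (p \<bullet> q)"

text \<open>For \<open>\<kappa> = 0\<close> the form degenerates to the product of the time
  components, so the spatial scalar product is required separately.\<close>

definition form_group :: "'a::real_inner \<Rightarrow> real \<Rightarrow> ('a \<Rightarrow> 'a) set" where
  "form_group e \<kappa> = {L. linear L \<and> (\<forall>p q. form e \<kappa> (L p) (L q) = form e \<kappa> p q)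
     \<and> (\<kappa> = 0 \<longrightarrow> (\<forall>p q. p \<bullet> e = 0 \<longrightarrow> q \<bullet> e = 0 \<longrightarrow> L p \<bullet> L q = p \<bullet> q))}"

definition speed_group :: "'a::real_inner \<Rightarrow> real \<Rightarrow> ('a \<Rightarrow> 'a) set" where
  "speed_group e \<kappa> = {L \<in> form_group e \<kappa>. L e \<bullet> e > 0}"

text \<open>For a unit vector \<open>e\<close> this is the squared length of the part of
  \<open>x\<close> orthogonal to \<open>e\<close>.\<close>

definition spat :: "'a::real_inner \<Rightarrow> 'a \<Rightarrow> real" where
  "spat e x = x \<bullet> x - (x \<bullet> e)\<^sup>2"

text \<open>The linear involution that exchanges \<open>e\<close> and \<open>x\<close> and fixes their orthogonal complement.\<close>

definition swap :: "'a::real_inner \<Rightarrow> 'a \<Rightarrow> 'a \<Rightarrow> 'a" where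
  "swap e x w = w - (w \<bullet> e - (1 + x \<bullet> e) / spat e x * (w \<bullet> x - (x \<bullet> e) * (w \<bullet> e))) *\<^sub>R (e - x)"

section \<open>Swaps and the groups of the forms\<close>

lemma linear_swap: "linear (swap e x)"
proof -
  have "linear (\<lambda>w. w - (w \<bullet> e - c * (w \<bullet> x - t * (w \<bullet> e))) *\<^sub>R d)" for c t and d :: 'a
    by (rule linearI) (simp_all add: inner_add_left algebra_simps)
  then show ?thesis unfolding swap_def[abs_def] .
qed

lemma form_inner_self: "e \<bullet> e = 1 \<Longrightarrow> form e \<kappa> x x = (x \<bullet> e)\<^sup>2 - \<kappa> * spat e x"
  by (simp add: form_def spat_def power2_eq_square algebra_simps)

lemma spat_eq: "e \<bullet> e = 1 \<Longrightarrow> spat e x = (x - (x \<bullet> e) *\<^sub>R e) \<bullet> (x - (x \<bullet> e) *\<^sub>R e)"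
  by (simp add: spat_def inner_diff_left inner_diff_right inner_commute power2_eq_square algebra_simps)

lemma spat_nonneg: "e \<bullet> e = 1 \<Longrightarrow> 0 \<le> spat e x"
  by (simp add: spat_eq)

lemma spat_zero: "e \<bullet> e = 1 \<Longrightarrow> spat e x = 0 \<Longrightarrow> x = (x \<bullet> e) *\<^sub>R e"
  by (simp add: spat_eq)

lemma spat_scale: "spat e (c *\<^sub>R x) = c\<^sup>2 * spat e x"
  by (simp add: spat_def power2_eq_square algebra_simps)

context
  fixes e :: "'a::real_inner"
  assumes unit: "e \<bullet> e = 1"
begin

lemma swap_e: "swap e x e = x"
  using unit by (simp add: swap_def inner_commute)

lemma swap_x:
  assumes "spat e x \<noteq> 0" shows "swap e x x = e"
proof -
  have "x \<bullet> x - (x \<bullet> e) * (x \<bullet> e) = spat e x" by (simp add: spat_def power2_eq_square)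
  then show ?thesis using assms by (simp add: swap_def)
qed

lemma swap_fix: "w \<bullet> e = 0 \<Longrightarrow> w \<bullet> x = 0 \<Longrightarrow> swap e x w = w"
  by (simp add: swap_def)

text \<open>\<open>spat e x\<close> is the Gram determinant of \<open>e\<close> and
  \<open>x\<close>, so both coefficients can be solved for.\<close>

lemma plane_decomposition:
  assumes "spat e x \<noteq> 0"
  obtains a b n where "w = a *\<^sub>R e + b *\<^sub>R x + n" "n \<bullet> e = 0" "n \<bullet> x = 0"
proof -
  define b where "b = (w \<bullet> x - (x \<bullet> e) * (w \<bullet> e)) / spat e x"
  define a where "a = w \<bullet> e - b * (x \<bullet> e)"
  define n where "n = w - a *\<^sub>R e - b *\<^sub>R x"
  have "n \<bullet> e = 0" by (simp add: n_def a_def inner_diff_left unit)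
  moreover have "n \<bullet> x = 0"
  proof -
    have "n \<bullet> x = w \<bullet> x - (x \<bullet> e) * (w \<bullet> e) - b * spat e x"
      by (simp add: n_def a_def inner_diff_left spat_def inner_commute[of e x] power2_eq_square algebra_simps)
    then show ?thesis using assms by (simp add: b_def)
  qed
  ultimately show thesis using that[of a b n] by (simp add: n_def)
qed

lemma swap_eqI:
  assumes s: "spat e x \<noteq> 0" and lin: "linear m" and m: "m e = x" "m x = e"
    and fx: "\<And>n. n \<bullet> e = 0 \<Longrightarrow> n \<bullet> x = 0 \<Longrightarrow> m n = n"
  shows "m = swap e x"
proof
  fix w
  obtain a b n where w: "w = a *\<^sub>R e + b *\<^sub>R x + n" "n \<bullet> e = 0" "n \<bullet> x = 0"
    by (rule plane_decomposition[OF s])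
  show "m w = swap e x w"
    unfolding w(1)
    by (simp add: linear_add[OF lin] linear_scale[OF lin] linear_add[OF linear_swap]
        linear_scale[OF linear_swap] m swap_e swap_x[OF s] fx[OF w(2,3)] swap_fix[OF w(2,3)])
qed

lemma swap_swap:
  assumes "spat e x \<noteq> 0" shows "swap e x (swap e x w) = w"
proof -
  obtain a b n where w: "w = a *\<^sub>R e + b *\<^sub>R x + n" "n \<bullet> e = 0" "n \<bullet> x = 0"
    by (rule plane_decomposition[OF assms])
  show ?thesis
    unfolding w(1)
    by (simp add: linear_add[OF linear_swap] linear_scale[OF linear_swap] swap_e swap_x[OF assms] swap_fix[OF w(2,3)])
qed

text \<open>For nonzero \<open>\<kappa>\<close> the swap is the reflection along
  \<open>e - x\<close> with respect to \<open>form\<close>. For \<open>\<kappa> = 0\<close> the form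
  vanishes on \<open>e - x\<close>, and on spatial vectors the swap is the Euclidean reflection with
  this coefficient, up to the choice of \<open>e - x\<close> as axis.\<close>

lemma swap_form_group:
  assumes s: "spat e x \<noteq> 0" and f: "(x \<bullet> e)\<^sup>2 - \<kappa> * spat e x = 1" and pos: "x \<bullet> e > 0"
  shows "swap e x \<in> form_group e \<kappa>"
proof -
  define T where "T = x \<bullet> e"
  define \<phi> where "\<phi> w = w \<bullet> e - (1 + T) / spat e x * (w \<bullet> x - T * (w \<bullet> e))" for w
  have sw: "swap e x w = w - \<phi> w *\<^sub>R (e - x)" for w
    unfolding swap_def \<phi>_def T_def ..
  have k: "\<kappa> = (T\<^sup>2 - 1) / spat e x" using f s by (simp add: T_def field_simps)
  have fl: "form e \<kappa> w (e - x) = (1 - T) * \<phi> w" for w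
  proof -
    have "form e \<kappa> w (e - x) = (1 - T) * (w \<bullet> e) + \<kappa> * (w \<bullet> x - T * (w \<bullet> e))"
      by (simp add: form_def inner_diff_left inner_diff_right unit T_def algebra_simps)
    then show ?thesis unfolding k \<phi>_def by (simp add: power2_eq_square add_divide_distrib diff_divide_distrib algebra_simps)
  qed
  have "\<phi> e = 1" using unit by (simp add: \<phi>_def T_def inner_commute)
  moreover have "\<phi> x = -1"
  proof -
    have "x \<bullet> x - T * (x \<bullet> e) = spat e x" by (simp add: spat_def T_def power2_eq_square)
    then show ?thesis using s by (simp add: \<phi>_def T_def)
  qed
  moreover have "\<phi> (e - x) = \<phi> e - \<phi> x" by (simp add: \<phi>_def inner_diff_left algebra_simps)
  ultimately have fd: "\<phi> (e - x) = 2" by simp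
  have bil: "form e \<kappa> (p - a *\<^sub>R d) (q - b *\<^sub>R d)
      = form e \<kappa> p q - b * form e \<kappa> p d - a * form e \<kappa> q d + a * b * form e \<kappa> d d" for p q d a b
    by (simp add: form_def inner_diff_left inner_diff_right inner_commute algebra_simps)
  have "form e \<kappa> (swap e x p) (swap e x q) = form e \<kappa> p q" for p q
    unfolding sw bil fl fd by (simp add: algebra_simps)
  moreover have "swap e x p \<bullet> swap e x q = p \<bullet> q" if "\<kappa> = 0" "p \<bullet> e = 0" "q \<bullet> e = 0" for p q
  proof -
    have "(x \<bullet> e)\<^sup>2 = 1" using f that(1) by simp
    \<comment> \<open>Positivity of the time component excludes \<open>T = -1\<close>.\<close>
    then have T: "T = 1" using pos by (simp add: T_def power2_eq_1_iff)
    have S: "(e - x) \<bullet> (e - x) = spat e x"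
      using T by (simp add: spat_def T_def inner_diff_left inner_diff_right inner_commute[of e x] unit)
    have "r \<bullet> (e - x) = - (r \<bullet> x)" if "r \<bullet> e = 0" for r using that by (simp add: inner_diff_right)
    moreover have "\<phi> r = - 2 * (r \<bullet> x) / spat e x" if "r \<bullet> e = 0" for r using that T by (simp add: \<phi>_def)
    ultimately have P: "p \<bullet> (e - x) = - (p \<bullet> x)" "q \<bullet> (e - x) = - (q \<bullet> x)"
      "\<phi> p = - 2 * (p \<bullet> x) / spat e x" "\<phi> q = - 2 * (q \<bullet> x) / spat e x" using that by auto
    have "swap e x p \<bullet> swap e x q
        = p \<bullet> q - \<phi> q * (p \<bullet> (e - x)) - \<phi> p * (q \<bullet> (e - x)) + \<phi> p * \<phi> q * ((e - x) \<bullet> (e - x))"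
      unfolding sw by (simp add: inner_diff_left inner_diff_right inner_commute algebra_simps)
    also have "\<dots> = p \<bullet> q" unfolding P S using s by (simp add: field_simps)
    finally show ?thesis .
  qed
  ultimately show ?thesis by (simp add: form_group_def linear_swap)
qed

lemma form_group_comp:
  assumes K: "K \<in> form_group e \<kappa>" and L: "L \<in> form_group e \<kappa>" shows "K \<circ> L \<in> form_group e \<kappa>"
proof -
  \<comment> \<open>In the degenerate case the spatial clause for \<open>K\<close> applies only
    after \<open>L\<close> is seen to keep spatial vectors spatial.\<close>
  have "L p \<bullet> e = 0" if "\<kappa> = 0" "p \<bullet> e = 0" for p
  proof -
    have "form e \<kappa> (L p) (L p) = form e \<kappa> p p" using L by (simp add: form_group_def)
    then show ?thesis using that by (simp add: form_def)
  qed
  then show ?thesis using K L by (auto simp: form_group_def intro: linear_compose)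
qed

lemma orthogonal_form_group:
  assumes "orthogonal_transformation k" "k e = e" shows "k \<in> form_group e \<kappa>"
proof -
  have "k p \<bullet> e = p \<bullet> e" for p using orthogonal_transformation_inner[OF assms(1), of p e] assms(2) by simp
  then show ?thesis using assms
    by (simp add: form_group_def form_def orthogonal_transformation_def)
qed

text \<open>Pairing with \<open>e\<close> under the form gives the time component, which is
  therefore preserved. The scalar product is then recovered from the form, or from the spatial
  clause if \<open>\<kappa> = 0\<close>.\<close>

lemma form_group_orthogonal:
  assumes L: "L \<in> form_group e \<kappa>" and fx: "L e = e" shows "orthogonal_transformation L"
proof -
  have lin: "linear L" using L by (simp add: form_group_def)
  have fe: "form e \<kappa> p e = p \<bullet> e" for p using unit by (simp add: form_def algebra_simps)
  have t: "L p \<bullet> e = p \<bullet> e" for p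
  proof -
    have "form e \<kappa> (L p) (L e) = form e \<kappa> p e" using L by (simp add: form_group_def)
    then show ?thesis using fx fe by simp
  qed
  have t': "e \<bullet> L p = e \<bullet> p" for p using t by (simp add: inner_commute)
  have "L p \<bullet> L q = p \<bullet> q" for p q
  proof (cases "\<kappa> = 0")
    case False
    have "form e \<kappa> (L p) (L q) = form e \<kappa> p q" using L by (simp add: form_group_def)
    then show ?thesis using False t by (simp add: form_def)
  next
    case True
    define p' q' where pq': "p' = p - (p \<bullet> e) *\<^sub>R e" "q' = q - (q \<bullet> e) *\<^sub>R e"
    have o: "p' \<bullet> e = 0" "q' \<bullet> e = 0" by (simp_all add: pq' inner_diff_left unit)
    then have "L p' \<bullet> L q' = p' \<bullet> q'" using L True by (simp add: form_group_def)
    moreover have "L p' = L p - (p \<bullet> e) *\<^sub>R e" "L q' = L q - (q \<bullet> e) *\<^sub>R e"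
      by (simp_all add: pq' linear_diff[OF lin] linear_scale[OF lin] fx)
    ultimately show ?thesis unfolding pq'
      by (simp add: inner_diff_left inner_diff_right t t' inner_commute unit)
  qed
  then show ?thesis using lin by (simp add: orthogonal_transformation_def)
qed

end

section \<open>Isotropic linear groups\<close>

text \<open>Abstracts the linear parts of worldview transformations: \<open>orthogonal\<close> and
  \<open>stab\<close> come from the two halves of Axiom II, \<open>time\<close> from the finite
  slope of worldlines, \<open>moving\<close> from Axiom I.\<close>

locale isotropic_group =
  fixes G :: "('a::euclidean_space \<Rightarrow> 'a) set" and e :: 'a
  assumes dim: "3 \<le> DIM('a)"
    and unit: "e \<bullet> e = 1"
    and lin: "g \<in> G \<Longrightarrow> linear g"
    and comp: "g \<in> G \<Longrightarrow> h \<in> G \<Longrightarrow> g \<circ> h \<in> G"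
    and inverse: "g \<in> G \<Longrightarrow> \<exists>h\<in>G. h \<circ> g = id \<and> g \<circ> h = id"
    and orthogonal: "orthogonal_transformation k \<Longrightarrow> k e = e \<Longrightarrow> k \<in> G"
    and stab: "g \<in> G \<Longrightarrow> g e = c *\<^sub>R e \<Longrightarrow> orthogonal_transformation g \<and> g e = e"
    and time: "g \<in> G \<Longrightarrow> g e \<bullet> e \<noteq> 0"
    and moving: "\<exists>g\<in>G. \<forall>c. g e \<noteq> c *\<^sub>R e"
begin

section \<open>The orbit of the unit time vector\<close>

definition "orbit = (\<lambda>g. g e) ` G"

definition "swaps = {x. spat e x \<noteq> 0 \<and> swap e x \<in> G}"

lemma orbitI: "g \<in> G \<Longrightarrow> g e \<in> orbit"
  by (auto simp: orbit_def)

lemma orbit_act: "g \<in> G \<Longrightarrow> x \<in> orbit \<Longrightarrow> g x \<in> orbit"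
  by (auto simp: orbit_def intro!: image_eqI[of _ _ "g \<circ> _"] comp)

lemma orbit_time: "x \<in> orbit \<Longrightarrow> x \<bullet> e \<noteq> 0"
  by (auto simp: orbit_def time)

text \<open>If \<open>g\<close> and \<open>h\<close> take \<open>e\<close> to \<open>x\<close> and
  to \<open>c *\<^sub>R x\<close>, then the inverse of \<open>g\<close> after \<open>h\<close>
  stretches \<open>e\<close> by \<open>c\<close>, and \<open>stab\<close> forces
  \<open>c = 1\<close>.\<close>

lemma orbit_ray:
  assumes "x \<in> orbit" "c *\<^sub>R x \<in> orbit" shows "c = 1"
proof -
  obtain g h where gh: "g \<in> G" "x = g e" "h \<in> G" "c *\<^sub>R x = h e" using assms by (auto simp: orbit_def)
  obtain g' where g': "g' \<in> G" "g' \<circ> g = id" using inverse[OF gh(1)] by blast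
  have "(g' \<circ> h) e = c *\<^sub>R g' x" using linear_scale[OF lin[OF g'(1)]] by (simp add: gh(4)[symmetric])
  also have "g' x = e" using g'(2) gh(2) by (metis comp_apply id_apply)
  finally have 1: "(g' \<circ> h) e = c *\<^sub>R e" .
  then have "c *\<^sub>R e = e" using stab[OF comp[OF g'(1) gh(3)] 1] by simp
  then have "(c *\<^sub>R e) \<bullet> e = e \<bullet> e" by (rule arg_cong)
  then show ?thesis using unit by simp
qed

lemma orbit_isotropic:
  assumes "x \<in> orbit" "x \<bullet> e = y \<bullet> e" "spat e x = spat e y" shows "y \<in> orbit"
proof -
  have "x \<bullet> x = y \<bullet> y" using assms(2,3) by (simp add: spat_def)
  then obtain k where "orthogonal_transformation k" "k e = e" "k x = y"
    using isotropic[OF assms(2)] by metis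
  then show ?thesis using orbit_act[OF orthogonal assms(1)] by metis
qed

text \<open>The assumption \<open>sp\<close> says that the squared speeds agree. Rescaling
  \<open>x\<close> to the time component of \<open>y\<close> then gives an orbit point by isotropy,
  and \<open>orbit_ray\<close> makes the factor \<open>1\<close>.\<close>

lemma orbit_speed:
  assumes xy: "x \<in> orbit" "y \<in> orbit" and sp: "spat e x * (y \<bullet> e)\<^sup>2 = spat e y * (x \<bullet> e)\<^sup>2"
  shows "x \<bullet> e = y \<bullet> e" "spat e x = spat e y"
proof -
  define c where "c = (y \<bullet> e) / (x \<bullet> e)"
  have nz: "x \<bullet> e \<noteq> 0" using xy by (simp add: orbit_time)
  have t: "(c *\<^sub>R x) \<bullet> e = y \<bullet> e" using nz by (simp add: c_def)
  have s: "spat e (c *\<^sub>R x) = spat e y"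
    using sp nz by (simp add: spat_scale c_def power_divide field_simps)
  have "c *\<^sub>R x \<in> orbit" using orbit_isotropic[OF xy(2)] t s by simp
  then have "c = 1" by (rule orbit_ray[OF xy(1)])
  then show "x \<bullet> e = y \<bullet> e" "spat e x = spat e y" using t s by simp_all
qed

section \<open>Swaps in the group\<close>

lemma swaps_orbit: "x \<in> swaps \<Longrightarrow> x \<in> orbit"
  using orbitI[of "swap e x"] by (simp add: swaps_def swap_e[OF unit])

text \<open>Conjugating \<open>swap e x\<close> by an isometry that fixes \<open>e\<close> and takes
  \<open>y\<close> to \<open>x\<close> gives \<open>swap e y\<close>.\<close>

lemma swaps_isotropic:
  assumes x: "x \<in> swaps" and "x \<bullet> e = y \<bullet> e" "spat e x = spat e y" shows "y \<in> swaps"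
proof -
  have "x \<bullet> x = y \<bullet> y" using assms(2,3) by (simp add: spat_def)
  then obtain k where k: "orthogonal_transformation k" "k e = e" "k y = x"
    using isotropic[of y e x] assms(2) by metis
  note ki = orthogonal_transformation_inner[OF k(1)]
  have kl: "linear k" using k(1) by (simp add: orthogonal_transformation_def)
  obtain k' where k': "k' \<in> G" "k' \<circ> k = id" using inverse[OF orthogonal[OF k(1,2)]] by blast
  have "swap e x (k w) = k (swap e y w)" for w
  proof -
    have "k w \<bullet> e = w \<bullet> e" "k w \<bullet> x = w \<bullet> y" using ki[of w e] ki[of w y] k(2,3) by simp_all
    then show ?thesis
      using k(2,3) assms(2,3) by (simp add: swap_def linear_diff[OF kl] linear_scale[OF kl])
  qed
  then have "swap e y = k' \<circ> (swap e x \<circ> k)"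
    using k'(2) by (auto simp: fun_eq_iff)
  then have "swap e y \<in> G"
    using x k' orthogonal[OF k(1,2)] by (simp add: swaps_def comp)
  then show ?thesis using x assms(3) by (simp add: swaps_def)
qed

text \<open>
  An involution of the group that moves points only along one line \<open>v\<close> has to fix the complement
  of \<open>e\<close> and \<open>m e\<close>: conjugating the reflection along a vector \<open>n\<close> of this complement gives an
  element fixing \<open>e\<close>, hence an isometry, and this forces \<open>m n = n\<close>.
\<close>

lemma involution_swap:
  assumes m: "m \<in> G" and inv: "\<And>w. m (m w) = w" and axis: "\<And>w. \<exists>c. m w = w + c *\<^sub>R v"
    and s: "spat e (m e) \<noteq> 0"
  shows "m e \<in> swaps"
proof -
  define x where "x = m e"
  have ml: "linear m" by (rule lin[OF m])
  have "spat e e = 0" using unit by (simp add: spat_def)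
  then have "x \<noteq> e" using s x_def by auto
  obtain c0 where c0: "x = e + c0 *\<^sub>R v" using axis[of e] x_def by blast
  have c0nz: "c0 \<noteq> 0" using c0 \<open>x \<noteq> e\<close> by auto
  have ax: "\<exists>c. m w = w + c *\<^sub>R (x - e)" for w
  proof -
    obtain c where "m w = w + c *\<^sub>R v" using axis by blast
    then have "m w = w + (c / c0) *\<^sub>R (x - e)" using c0 c0nz by simp
    then show ?thesis ..
  qed
  have mx: "m x = e" using inv by (simp add: x_def)
  have fx: "m n = n" if n: "n \<bullet> e = 0" "n \<bullet> x = 0" for n
  proof -
    obtain c where c: "m n = n + c *\<^sub>R (x - e)" using ax by blast
    define k where "k = m \<circ> mirror n \<circ> m"
    have rl: "linear (mirror n)" using mirror_orthogonal orthogonal_transformation_def by blast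
    have re: "mirror n e = e" "mirror n x = x" using n by (simp_all add: mirror_fix inner_commute)
    have "k \<in> G" unfolding k_def using re by (intro comp m orthogonal mirror_orthogonal)
    moreover have ke: "k e = e" using re inv by (simp add: k_def x_def[symmetric] mx)
    then have "k e = 1 *\<^sub>R e" by simp
    ultimately have ko: "orthogonal_transformation k" using stab by blast
    have kx: "k x = x" using re by (simp add: k_def mx) (simp add: x_def)
    have kn: "k n = - n - (2 * c) *\<^sub>R (x - e)"
      unfolding k_def comp_apply c linear_add[OF rl] linear_scale[OF rl] linear_diff[OF rl] re mirror_self
        linear_add[OF ml] linear_scale[OF ml] linear_diff[OF ml] linear_neg[OF ml]
      by (simp add: c mx x_def[symmetric] algebra_simps scaleR_2[symmetric])
    have no: "n \<bullet> (x - e) = 0" using n by (simp add: inner_diff_right)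
    have "(- n - a *\<^sub>R d) \<bullet> d = - (n \<bullet> d) - a * (d \<bullet> d)" for a d
      by (simp add: inner_diff_left)
    \<comment> \<open>An isometry fixing \<open>x - e\<close> keeps \<open>n\<close> orthogonal to
      \<open>x - e\<close>, so the component \<open>- (2 * c)\<close> of \<open>k n\<close> along it
      must vanish.\<close>
    then have "k n \<bullet> (x - e) = - 2 * c * ((x - e) \<bullet> (x - e))" unfolding kn using no by simp
    moreover have "k (x - e) = x - e"
      using linear_diff[of k x e] ko ke kx by (simp add: orthogonal_transformation_def)
    then have "k n \<bullet> (x - e) = n \<bullet> (x - e)" using orthogonal_transformation_inner[OF ko, of n "x - e"] by simp
    moreover note no
    moreover have "(x - e) \<bullet> (x - e) \<noteq> 0" using \<open>x \<noteq> e\<close> by simp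
    ultimately have "c = 0" by (metis mult_eq_0_iff neg_equal_0_iff_equal zero_neq_numeral)
    then show ?thesis using c by simp
  qed
  have s': "spat e x \<noteq> 0" using s x_def by simp
  have "m = swap e x" by (rule swap_eqI[OF unit s' ml x_def[symmetric] mx fx])
  then show ?thesis using m s unfolding swaps_def x_def[symmetric] by simp
qed

text \<open>The conjugated reflection is an involution that moves points only along
  \<open>g n\<close>, as \<open>involution_swap\<close> requires.\<close>

lemma conj_mirror_swap:
  assumes g: "g \<in> G" "h \<in> G" "h \<circ> g = id" "g \<circ> h = id" and n: "n \<bullet> e = 0"
    and s: "spat e (g (mirror n (h e))) \<noteq> 0"
  shows "g (mirror n (h e)) \<in> swaps"
proof -
  define m where "m = g \<circ> mirror n \<circ> h"
  have gh: "g (h w) = w" "h (g w) = w" for w using g by (metis comp_apply id_apply)+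
  have "m \<in> G" unfolding m_def using n
    by (intro comp g orthogonal mirror_orthogonal) (simp add: mirror_fix inner_commute)
  moreover have "m (m w) = w" for w by (simp add: m_def gh mirror_mirror)
  moreover have "\<exists>c. m w = w + c *\<^sub>R g n" for w
  proof -
    have "m w = g (h w) + (- (2 * (h w \<bullet> n) / (n \<bullet> n))) *\<^sub>R g n"
      by (simp add: m_def mirror_def linear_diff[OF lin[OF g(1)]] linear_scale[OF lin[OF g(1)]])
    then show ?thesis unfolding gh by blast
  qed
  ultimately show ?thesis using involution_swap[of m "g n"] s by (simp add: m_def)
qed

text \<open>Conjugating the reflection along the spatial part \<open>n\<close> of \<open>h e\<close>
  moves \<open>e\<close> by \<open>- 2 *\<^sub>R g n\<close>. If the result were on the time axis,
  so would be \<open>g n\<close>, and the spatial vector \<open>n\<close> would be a multiple of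
  \<open>h e\<close>, which has a time component.\<close>

lemma swaps_nonempty: "swaps \<noteq> {}"
proof -
  obtain g where g: "g \<in> G" "\<And>c. g e \<noteq> c *\<^sub>R e" using moving by blast
  obtain h where h: "h \<in> G" "h \<circ> g = id" "g \<circ> h = id" using inverse[OF g(1)] by blast
  have gh: "g (h w) = w" "h (g w) = w" for w using h by (metis comp_apply id_apply)+
  note gl = lin[OF g(1)]
  define y where "y = h e"
  define n where "n = y - (y \<bullet> e) *\<^sub>R e"
  have yt: "y \<bullet> e \<noteq> 0" using time[OF h(1)] by (simp add: y_def)
  have ne: "n \<bullet> e = 0" using unit by (simp add: n_def inner_diff_left)
  have nnz: "n \<noteq> 0"
  proof
    assume "n = 0"
    then have "y = (y \<bullet> e) *\<^sub>R e" by (simp add: n_def)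
    then have "g y = (y \<bullet> e) *\<^sub>R g e" using linear_scale[OF gl] by metis
    then have "e = (y \<bullet> e) *\<^sub>R g e" using gh by (simp add: y_def)
    then have "g e = (1 / (y \<bullet> e)) *\<^sub>R e"
      using yt by (metis divide_self scaleR_one scaleR_scaleR times_divide_eq_left mult_1)
    then show False using g(2) by blast
  qed
  have "y \<bullet> n = n \<bullet> n"
    using ne by (simp add: n_def inner_diff_left inner_diff_right inner_commute)
  then have "mirror n y = y - 2 *\<^sub>R n" using nnz by (simp add: mirror_def)
  then have mx: "g (mirror n y) = e - 2 *\<^sub>R g n"
    using gh by (simp add: linear_diff[OF gl] linear_scale[OF gl] y_def)
  have "spat e (g (mirror n y)) \<noteq> 0"
  proof
    assume "spat e (g (mirror n y)) = 0"
    then obtain c where "e - 2 *\<^sub>R g n = c *\<^sub>R e" using spat_zero[OF unit] mx by metis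
    then have "2 *\<^sub>R g n = (1 - c) *\<^sub>R e" by (simp add: algebra_simps)
    then have "(1 / 2) *\<^sub>R (2 *\<^sub>R g n) = (1 / 2) *\<^sub>R ((1 - c) *\<^sub>R e)" by simp
    then have gn: "g n = ((1 - c) / 2) *\<^sub>R e" by simp
    then have "h (g n) = ((1 - c) / 2) *\<^sub>R y" using linear_scale[OF lin[OF h(1)]] by (simp add: y_def)
    then have n: "n = ((1 - c) / 2) *\<^sub>R y" using gh by simp
    then have "((1 - c) / 2) * (y \<bullet> e) = 0" using ne by (metis inner_scaleR_left)
    then show False using n nnz yt by auto
  qed
  then have "g (mirror n y) \<in> swaps"
    using conj_mirror_swap[OF g(1) h ne] by (simp add: y_def)
  then show ?thesis by blast
qed

text \<open>
  The point \<open>y\<close> is the image of \<open>e\<close> under the conjugate by \<open>swap e x\<close> of a reflection along a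
  spatial vector, and \<open>C\<close> is the squared cosine of the angle between this vector and \<open>x\<close>'s spatial part.
\<close>

lemma swaps_family:
  assumes x: "x \<in> swaps" and C: "0 \<le> C" "C \<le> 1"
  defines "T \<equiv> x \<bullet> e" and "R \<equiv> spat e x"
  obtains y where "y \<in> orbit" "y \<bullet> e = 1 + 2 * (T\<^sup>2 - 1) * C"
    "spat e y = 4 * R * C * (1 + (T\<^sup>2 - 1) * C)" "spat e y \<noteq> 0 \<Longrightarrow> y \<in> swaps"
proof -
  have sG: "swap e x \<in> G" and R0: "R \<noteq> 0" using x by (simp_all add: swaps_def R_def)
  then have Rp: "R > 0" using spat_nonneg[OF unit, of x] by (simp add: R_def)
  define \<rho> where "\<rho> = x - T *\<^sub>R e"
  have \<rho>: "\<rho> \<bullet> e = 0" "\<rho> \<bullet> \<rho> = R" using unit spat_eq[OF unit, of x]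
    by (simp_all add: \<rho>_def T_def R_def inner_diff_left)
  obtain u where u: "u \<bullet> u = 1" "u \<bullet> e = 0" "u \<bullet> \<rho> = 0" using obtain_orthogonal[OF dim] by metis
  define n where "n = (sqrt C / sqrt R) *\<^sub>R \<rho> + sqrt (1 - C) *\<^sub>R u"
  have n: "n \<bullet> e = 0" "n \<bullet> n = 1" "n \<bullet> \<rho> = sqrt C * sqrt R"
  proof -
    show "n \<bullet> e = 0" using \<rho> u by (simp add: n_def inner_add_left)
    have "n \<bullet> n = (sqrt C / sqrt R) * (sqrt C / sqrt R) * R + sqrt (1 - C) * sqrt (1 - C)"
      using \<rho> u by (simp add: n_def inner_add_left inner_add_right inner_commute[of \<rho> u])
    also have "\<dots> = 1" using C Rp by (simp add: field_simps)
    finally show "n \<bullet> n = 1" .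
    have "n \<bullet> \<rho> = sqrt C / sqrt R * R" using \<rho> u by (simp add: n_def inner_add_left)
    also have "\<dots> = sqrt C * sqrt R" using Rp by (simp add: field_simps)
    finally show "n \<bullet> \<rho> = sqrt C * sqrt R" .
  qed
  define \<nu> where "\<nu> = n \<bullet> \<rho>"
  have \<nu>2: "\<nu> * \<nu> = C * R" 
    unfolding \<nu>_def n(3) real_sqrt_mult[symmetric] using C Rp by simp
  have nx: "n \<bullet> x = \<nu>" using n(1) by (simp add: \<nu>_def \<rho>_def inner_diff_right)
  have sn: "swap e x n = n + ((1 + T) / R * \<nu>) *\<^sub>R (e - x)"
    using n(1) nx by (simp add: swap_def T_def R_def)
  define y where "y = swap e x (mirror n (swap e x e))"
  have "y = swap e x (x - (2 * \<nu>) *\<^sub>R n)"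
    unfolding y_def swap_e[OF unit] mirror_def using n(2) nx by (simp add: inner_commute)
  also have "\<dots> = e - (2 * \<nu>) *\<^sub>R swap e x n"
    using R0 by (simp add: linear_diff[OF linear_swap] linear_scale[OF linear_swap] swap_x[OF unit] R_def)
  also have "\<dots> = e - (2 * \<nu>) *\<^sub>R n - (2 * (1 + T) * (\<nu> * \<nu> / R)) *\<^sub>R (e - x)"
  proof -
    have *: "2 * \<nu> * ((1 + T) / R * \<nu>) = 2 * (1 + T) * (\<nu> * \<nu> / R)" by simp
    show ?thesis unfolding sn scaleR_right_distrib scaleR_scaleR * diff_diff_eq ..
  qed
  also have "\<nu> * \<nu> / R = C" using \<nu>2 R0 by simp
  also have "e - (2 * \<nu>) *\<^sub>R n - (2 * (1 + T) * C) *\<^sub>R (e - x)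
      = (1 - 2 * (1 + T) * C * (1 - T)) *\<^sub>R e + ((2 * (1 + T) * C) *\<^sub>R \<rho> - (2 * \<nu>) *\<^sub>R n)"
    by (simp add: \<rho>_def algebra_simps)
  finally have y: "y = (1 - 2 * (1 + T) * C * (1 - T)) *\<^sub>R e + ((2 * (1 + T) * C) *\<^sub>R \<rho> - (2 * \<nu>) *\<^sub>R n)"
    (is "y = ?t *\<^sub>R e + ?s") .
  have se: "?s \<bullet> e = 0" using \<rho> n by (simp add: inner_diff_left)
  then have ye: "y \<bullet> e = ?t" using unit by (simp add: y inner_add_left)
  have "spat e y = ?s \<bullet> ?s"
    unfolding spat_eq[OF unit, of y] ye by (simp add: y)
  also have "\<dots> = (2 * (1 + T) * C)\<^sup>2 * R - 2 * (2 * (1 + T) * C) * (2 * \<nu>) * \<nu> + (2 * \<nu>)\<^sup>2"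
    using \<rho>(2) n(2) by (simp add: inner_diff_left inner_diff_right \<nu>_def inner_commute[of \<rho> n] power2_eq_square algebra_simps)
  also have "\<dots> = (2 * (1 + T) * C)\<^sup>2 * R - 8 * (1 + T) * C * (\<nu> * \<nu>) + 4 * (\<nu> * \<nu>)"
    by (simp add: power2_eq_square algebra_simps)
  also have "\<dots> = 4 * R * C * (1 + (T\<^sup>2 - 1) * C)"
    unfolding \<nu>2 by (simp add: power2_eq_square algebra_simps)
  finally have ys: "spat e y = 4 * R * C * (1 + (T\<^sup>2 - 1) * C)" .
  show thesis
  proof
    have "mirror n \<in> G" using n(1) by (intro orthogonal mirror_orthogonal) (simp add: mirror_fix inner_commute)
    from orbit_act[OF sG orbit_act[OF this orbitI[OF sG]]] show "y \<in> orbit" by (simp only: y_def)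
    show "y \<bullet> e = 1 + 2 * (T\<^sup>2 - 1) * C" unfolding ye by (simp add: power2_eq_square algebra_simps)
    show "spat e y = 4 * R * C * (1 + (T\<^sup>2 - 1) * C)" by (rule ys)
    have "swap e x \<circ> swap e x = id" using R0 by (auto simp: R_def swap_swap[OF unit])
    then show "y \<in> swaps" if "spat e y \<noteq> 0"
      using conj_mirror_swap[OF sG sG _ _ n(1)] that by (simp add: y_def)
  qed
qed

text \<open>The time components in the family of \<open>x\<close> run from \<open>1\<close> at
  \<open>C = 0\<close> to \<open>2 * (x \<bullet> e)\<^sup>2 - 1\<close> at \<open>C = 1\<close>. If
  the latter were not positive, they would vanish at \<open>C = 1 / (2 * ?a)\<close>, which no orbit
  point allows.\<close>

lemma swaps_time:
  assumes "x \<in> swaps" shows "2 * (x \<bullet> e)\<^sup>2 - 1 > 0"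
proof (rule ccontr)
  let ?a = "1 - (x \<bullet> e)\<^sup>2"
  assume "\<not> ?thesis"
  then have a: "2 * ?a \<ge> 1" by simp
  then have "0 \<le> 1 / (2 * ?a)" "1 / (2 * ?a) \<le> 1" by (simp_all add: field_simps)
  from swaps_family[OF assms this] obtain y where y: "y \<in> orbit"
    "y \<bullet> e = 1 + 2 * ((x \<bullet> e)\<^sup>2 - 1) * (1 / (2 * ?a))" by metis
  have "2 * ((x \<bullet> e)\<^sup>2 - 1) * (1 / (2 * ?a)) = -1" using a by (simp add: field_simps)
  then show False using y orbit_time by simp
qed

text \<open>A convex combination of the two positive end values.\<close>

lemma family_time_pos:
  assumes "x \<in> swaps" "0 \<le> C" "C \<le> 1" shows "1 + 2 * ((x \<bullet> e)\<^sup>2 - 1) * C > 0"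
proof -
  have "1 + 2 * ((x \<bullet> e)\<^sup>2 - 1) * C = (1 - C) + C * (2 * (x \<bullet> e)\<^sup>2 - 1)" by (simp add: algebra_simps)
  moreover have "C * (2 * (x \<bullet> e)\<^sup>2 - 1) \<ge> 0" using swaps_time[OF assms(1)] assms by simp
  moreover have "C * (2 * (x \<bullet> e)\<^sup>2 - 1) > 0 \<or> C = 0" using swaps_time[OF assms(1)] assms by auto
  ultimately show ?thesis using assms by linarith
qed

section \<open>The constant of the invariant form\<close>

definition "kappa x = ((x \<bullet> e)\<^sup>2 - 1) / spat e x"

text \<open>Equivalently \<open>form e (kappa x) x x = 1\<close>: this constant gives
  \<open>x\<close> the same value of the form as \<open>e\<close>.\<close>

lemma kappa_eq: "x \<in> swaps \<Longrightarrow> (x \<bullet> e)\<^sup>2 - 1 = kappa x * spat e x"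
  by (simp add: kappa_def swaps_def)

text \<open>Stated without division so that it also covers \<open>spat e y = 0\<close>.\<close>

lemma family_kappa:
  assumes x: "x \<in> swaps" and y: "y \<bullet> e = 1 + 2 * ((x \<bullet> e)\<^sup>2 - 1) * C"
    "spat e y = 4 * spat e x * C * (1 + ((x \<bullet> e)\<^sup>2 - 1) * C)"
  shows "(y \<bullet> e)\<^sup>2 - 1 = kappa x * spat e y"
proof -
  have "kappa x * spat e y = (kappa x * spat e x) * (4 * C * (1 + ((x \<bullet> e)\<^sup>2 - 1) * C))"
    unfolding y(2) by simp
  also have "\<dots> = (y \<bullet> e)\<^sup>2 - 1"
    unfolding kappa_eq[OF x, symmetric] y(1) by (simp add: power2_eq_square algebra_simps)
  finally show ?thesis ..
qed

text \<open>The member \<open>C = 1\<close> of the family: the formulas are those for a doubled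
  angle or rapidity.\<close>

lemma swaps_double:
  assumes x: "x \<in> swaps"
  obtains y where "y \<in> swaps" "y \<bullet> e = 2 * (x \<bullet> e)\<^sup>2 - 1" "spat e y = 4 * spat e x * (x \<bullet> e)\<^sup>2"
proof -
  obtain y where y: "y \<in> orbit" "y \<bullet> e = 1 + 2 * ((x \<bullet> e)\<^sup>2 - 1) * 1"
    "spat e y = 4 * spat e x * 1 * (1 + ((x \<bullet> e)\<^sup>2 - 1) * 1)" "spat e y \<noteq> 0 \<Longrightarrow> y \<in> swaps"
    using swaps_family[OF x, of 1] by auto
  have "x \<bullet> e \<noteq> 0" "spat e x \<noteq> 0" using x orbit_time swaps_orbit by (auto simp: swaps_def)
  then have "spat e y \<noteq> 0" using y(3) by simp
  then show thesis using that[of y] y by simp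
qed

text \<open>
  The speeds in the family of a swap form an interval starting at \<open>0\<close>, so any two families share
  a nonzero speed, and the time component and the length of an orbit point depend only on its speed.
\<close>

lemma kappa_unique_aux:
  assumes x: "x1 \<in> swaps" "x2 \<in> swaps"
  defines "h \<equiv> \<lambda>x C. 4 * spat e x * C * (1 + ((x \<bullet> e)\<^sup>2 - 1) * C) / (1 + 2 * ((x \<bullet> e)\<^sup>2 - 1) * C)\<^sup>2"
  assumes le: "h x1 1 \<le> h x2 1"
  shows "kappa x1 = kappa x2"
proof -
  obtain y1 where y1: "y1 \<in> orbit" "y1 \<bullet> e = 1 + 2 * ((x1 \<bullet> e)\<^sup>2 - 1) * 1"
    "spat e y1 = 4 * spat e x1 * 1 * (1 + ((x1 \<bullet> e)\<^sup>2 - 1) * 1)"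
    using swaps_family[OF x(1), of 1] by auto
  have nz: "spat e y1 > 0"
    using x(1) orbit_time swaps_orbit spat_nonneg[OF unit, of x1]
    by (auto simp: y1(3) swaps_def order_less_le)
  \<comment> \<open>\<open>h x C\<close> is the squared speed of the family member with parameter
    \<open>C\<close>.\<close>
  have h1: "h x1 1 = spat e y1 / (y1 \<bullet> e)\<^sup>2" unfolding h_def y1(2,3) by simp
  \<comment> \<open>The speeds in the family of \<open>x2\<close> run continuously from
    \<open>0\<close> to \<open>h x2 1\<close>, so the speed of \<open>y1\<close> is attained among
    them.\<close>
  have "continuous_on {0..1} (h x2)"
    unfolding h_def using family_time_pos[OF x(2)] by (intro continuous_intros) fastforce
  moreover have "h x2 0 \<le> h x1 1" unfolding h1 using nz by (simp add: h_def)
  ultimately obtain C where C: "0 \<le> C" "C \<le> 1" "h x2 C = h x1 1"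
    using IVT'[of "h x2" 0 "h x1 1" 1] le by auto
  obtain y2 where y2: "y2 \<in> orbit" "y2 \<bullet> e = 1 + 2 * ((x2 \<bullet> e)\<^sup>2 - 1) * C"
    "spat e y2 = 4 * spat e x2 * C * (1 + ((x2 \<bullet> e)\<^sup>2 - 1) * C)"
    using swaps_family[OF x(2) C(1,2)] by auto
  have "h x2 C = spat e y2 / (y2 \<bullet> e)\<^sup>2" unfolding h_def y2(2,3) ..
  then have "spat e y1 / (y1 \<bullet> e)\<^sup>2 = spat e y2 / (y2 \<bullet> e)\<^sup>2" using C h1 by simp
  then have "spat e y1 * (y2 \<bullet> e)\<^sup>2 = spat e y2 * (y1 \<bullet> e)\<^sup>2"
    using orbit_time[OF y1(1)] orbit_time[OF y2(1)] by (simp add: field_simps)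
  from orbit_speed[OF y1(1) y2(1) this]
  have "kappa x1 * spat e y1 = kappa x2 * spat e y1"
    using family_kappa[OF x(1) y1(2,3)] family_kappa[OF x(2) y2(2,3)] by metis
  then show ?thesis using nz by simp
qed

lemma kappa_unique: "x1 \<in> swaps \<Longrightarrow> x2 \<in> swaps \<Longrightarrow> kappa x1 = kappa x2"
  using kappa_unique_aux[of x1 x2] kappa_unique_aux[of x2 x1] by (metis linear)

text \<open>
  For negative \<open>\<kappa>\<close> the swaps would be rotations mixing space and time, and doubling their angles
  would eventually turn \<open>e\<close> into a vector without time component.
\<close>

lemma kappa_nonneg:
  assumes x: "x \<in> swaps" shows "kappa x \<ge> 0"
proof (rule ccontr)
  assume neg: "\<not> kappa x \<ge> 0"
  have lt1: "y \<bullet> e < 1" if y: "y \<in> swaps" for y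
  proof -
    have "(y \<bullet> e)\<^sup>2 - 1 = kappa x * spat e y" using kappa_eq[OF y] kappa_unique[OF x y] by simp
    also have "\<dots> < 0" using neg y spat_nonneg[OF unit, of y]
      by (intro mult_neg_pos) (auto simp: swaps_def order_less_le)
    finally show ?thesis by (metis diff_less_0_iff_less not_less one_le_power)
  qed
  \<comment> \<open>Doubled once so that \<open>swaps_time\<close> makes the time component
    positive.\<close>
  obtain y0 where y0: "y0 \<in> swaps" "y0 \<bullet> e = 2 * (x \<bullet> e)\<^sup>2 - 1" using swaps_double[OF x] by metis
  \<comment> \<open>Doubling multiplies \<open>1 - y \<bullet> e\<close> by
    \<open>2 * (1 + y \<bullet> e)\<close>, which is at least \<open>2\<close>, and keeps the time
    component positive. The difference would outgrow \<open>1\<close>, which is absurd.\<close>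
  have "\<exists>y\<in>swaps. 0 < y \<bullet> e \<and> 2 ^ n * (1 - y0 \<bullet> e) \<le> 1 - y \<bullet> e" for n
  proof (induction n)
    case 0
    then show ?case using y0 swaps_time[OF x] by (intro bexI[of _ y0]) simp_all
  next
    case (Suc n)
    then obtain y where y: "y \<in> swaps" "0 < y \<bullet> e" "2 ^ n * (1 - y0 \<bullet> e) \<le> 1 - y \<bullet> e" by blast
    obtain z where z: "z \<in> swaps" "z \<bullet> e = 2 * (y \<bullet> e)\<^sup>2 - 1" using swaps_double[OF y(1)] by metis
    have "2 * (1 - y \<bullet> e) * 1 \<le> 2 * (1 - y \<bullet> e) * (1 + y \<bullet> e)"
      using y(2) lt1[OF y(1)] by (intro mult_left_mono) simp_all
    also have "\<dots> = 1 - z \<bullet> e" unfolding z(2) by (simp add: power2_eq_square algebra_simps)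
    finally show ?case using y(3) z swaps_time[OF y(1)] by (intro bexI[of _ z]) simp_all
  qed
  note grow = this
  have p: "1 - y0 \<bullet> e > 0" using lt1[OF y0(1)] by simp
  obtain n where n: "1 / (1 - y0 \<bullet> e) < 2 ^ n" using real_arch_pow[of 2] by auto
  then have "1 < 2 ^ n * (1 - y0 \<bullet> e)" using p by (simp add: field_simps)
  then show False using grow[of n] by auto
qed

text \<open>Repeated doubling reaches a swap beyond \<open>z\<close>, whose family contains a swap
  with the time component and spatial length of \<open>z\<close>; isotropy carries it to
  \<open>z\<close>. What grows is \<open>spat\<close> for \<open>\<kappa> = 0\<close> and the time
  component for \<open>\<kappa> > 0\<close>.\<close>

lemma swaps_exist:
  assumes x0: "x0 \<in> swaps" and z: "z \<bullet> e \<ge> 1" "spat e z \<noteq> 0" "(z \<bullet> e)\<^sup>2 - kappa x0 * spat e z = 1"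
  shows "z \<in> swaps"
proof -
  define \<kappa> where "\<kappa> = kappa x0"
  have k: "(x \<bullet> e)\<^sup>2 - 1 = \<kappa> * spat e x" if "x \<in> swaps" for x
    using kappa_eq[OF that] kappa_unique[OF x0 that] by (simp add: \<kappa>_def)
  have zp: "spat e z > 0" using z(2) spat_nonneg[OF unit, of z] by simp
  have pos: "spat e x > 0" if "x \<in> swaps" for x
    using that spat_nonneg[OF unit, of x] by (simp add: swaps_def)
  have "\<exists>y\<in>swaps. y \<bullet> e = z \<bullet> e \<and> spat e y = spat e z"
  proof (cases "\<kappa> = 0")
    case True
    have one: "(x \<bullet> e)\<^sup>2 = 1" if "x \<in> swaps" for x using k[OF that] True by simp
    have "\<exists>x\<in>swaps. 2 ^ n * spat e x0 \<le> spat e x" for n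
    proof (induction n)
      case 0
      show ?case using x0 by auto
    next
      case (Suc n)
      then obtain x where x: "x \<in> swaps" "2 ^ n * spat e x0 \<le> spat e x" by blast
      obtain y where "y \<in> swaps" "spat e y = 4 * spat e x * (x \<bullet> e)\<^sup>2"
        using swaps_double[OF x(1)] by metis
      moreover have "2 * (2 ^ n * spat e x0) \<le> 4 * spat e x" using x(2) pos[OF x(1)] by linarith
      ultimately show ?case using one[OF x(1)] by (intro bexI[of _ y]) simp_all
    qed
    note grow = this
    obtain n where n: "spat e z / spat e x0 < 2 ^ n" using real_arch_pow[of 2] by auto
    obtain x where x: "x \<in> swaps" "2 ^ n * spat e x0 \<le> spat e x" using grow by blast
    have zx: "spat e z < spat e x" using n x(2) pos[OF x0] by (simp add: field_simps)
    \<comment> \<open>With \<open>(x \<bullet> e)\<^sup>2 = 1\<close> the family has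
      \<open>spat e y = 4 * spat e x * C\<close>; this is solved for
      \<open>spat e z\<close>.\<close>
    define C where "C = spat e z / (4 * spat e x)"
    have C: "0 \<le> C" "C \<le> 1" using zx zp by (simp_all add: C_def field_simps)
    obtain y where y: "y \<bullet> e = 1 + 2 * ((x \<bullet> e)\<^sup>2 - 1) * C"
      "spat e y = 4 * spat e x * C * (1 + ((x \<bullet> e)\<^sup>2 - 1) * C)" "spat e y \<noteq> 0 \<Longrightarrow> y \<in> swaps"
      using swaps_family[OF x(1) C] by metis
    have "spat e y = spat e z" using pos[OF x(1)] by (simp add: y(2) one[OF x(1)] C_def)
    moreover have "(z \<bullet> e)\<^sup>2 = 1" using z(3) True by (simp add: \<kappa>_def)
    then have "z \<bullet> e = 1" using z(1) by (simp add: power2_eq_1_iff)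
    ultimately show ?thesis using y z(2) by (intro bexI[of _ y]) (simp_all add: one[OF x(1)])
  next
    case False
    then have kp: "\<kappa> > 0" using kappa_nonneg[OF x0] by (simp add: \<kappa>_def)
    \<comment> \<open>The sign of \<open>x0 \<bullet> e\<close> is not known here, but the double
      has time component above \<open>1\<close>.\<close>
    obtain y0 where y0: "y0 \<in> swaps" "y0 \<bullet> e = 2 * (x0 \<bullet> e)\<^sup>2 - 1" using swaps_double[OF x0] by metis
    have "(x0 \<bullet> e)\<^sup>2 - 1 > 0" using k[OF x0] kp pos[OF x0] by simp
    then have d: "y0 \<bullet> e - 1 > 0" using y0(2) by simp
    have "\<exists>x\<in>swaps. 1 + 2 ^ n * (y0 \<bullet> e - 1) \<le> x \<bullet> e" for n
    proof (induction n)
      case 0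
      show ?case using y0(1) by (intro bexI[of _ y0]) simp_all
    next
      case (Suc n)
      then obtain x where x: "x \<in> swaps" "1 + 2 ^ n * (y0 \<bullet> e - 1) \<le> x \<bullet> e" by blast
      obtain y where y: "y \<in> swaps" "y \<bullet> e = 2 * (x \<bullet> e)\<^sup>2 - 1" using swaps_double[OF x(1)] by metis
      have "0 \<le> 2 ^ n * (y0 \<bullet> e - 1)" using d by simp
      then have x1: "x \<bullet> e \<ge> 1" using x(2) by linarith
      then have "2 * (x \<bullet> e - 1) * 1 \<le> 2 * (x \<bullet> e - 1) * (x \<bullet> e + 1)" by (intro mult_left_mono) simp_all
      also have "\<dots> = y \<bullet> e - 1" unfolding y(2) by (simp add: power2_eq_square algebra_simps)
      finally show ?case using x(2) y(1) by (intro bexI[of _ y]) simp_all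
    qed
    note grow = this
    obtain n where n: "(z \<bullet> e) / (y0 \<bullet> e - 1) < 2 ^ n" using real_arch_pow[of 2] by auto
    obtain x where x: "x \<in> swaps" "1 + 2 ^ n * (y0 \<bullet> e - 1) \<le> x \<bullet> e" using grow by blast
    have "z \<bullet> e < 2 ^ n * (y0 \<bullet> e - 1)" using n d by (simp add: field_simps)
    then have xz: "z \<bullet> e \<le> x \<bullet> e" using x(2) by linarith
    define a where "a = (x \<bullet> e)\<^sup>2 - 1"
    have a: "a > 0" using k[OF x(1)] kp pos[OF x(1)] by (simp add: a_def)
    have "(x \<bullet> e) * 1 \<le> (x \<bullet> e) * (x \<bullet> e)" using xz z(1) by (intro mult_left_mono) simp_all
    then have za: "z \<bullet> e - 1 \<le> a" using xz by (simp add: a_def power2_eq_square)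
    \<comment> \<open>Solves \<open>1 + 2 * a * C = z \<bullet> e\<close>.\<close>
    define C where "C = (z \<bullet> e - 1) / (2 * a)"
    have C: "0 \<le> C" "C \<le> 1" using za z(1) a by (simp_all add: C_def field_simps)
    obtain y where y: "y \<bullet> e = 1 + 2 * ((x \<bullet> e)\<^sup>2 - 1) * C"
      "spat e y = 4 * spat e x * C * (1 + ((x \<bullet> e)\<^sup>2 - 1) * C)" "spat e y \<noteq> 0 \<Longrightarrow> y \<in> swaps"
      using swaps_family[OF x(1) C] by metis
    have t: "y \<bullet> e = z \<bullet> e" using a unfolding y(1) by (simp add: C_def a_def[symmetric])
    have "(y \<bullet> e)\<^sup>2 - 1 = \<kappa> * spat e y"
      using family_kappa[OF x(1) y(1,2)] kappa_unique[OF x0 x(1)] by (simp add: \<kappa>_def)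
    then have "\<kappa> * spat e y = \<kappa> * spat e z" using z(3) unfolding t \<kappa>_def[symmetric] by linarith
    then have "spat e y = spat e z" using kp by simp
    then show ?thesis using t y(3) z(2) by auto
  qed
  then show ?thesis using swaps_isotropic by metis
qed

text \<open>Here \<open>y\<close> has the value \<open>1\<close> under the form and lies in the
  plane of \<open>e\<close> and \<open>z\<close>, so the last formula is the time coordinate after a
  boost along the spatial part of \<open>z\<close>.\<close>

lemma swap_time:
  assumes z: "spat e z \<noteq> 0" and l: "l \<noteq> 0" and T: "T\<^sup>2 - 1 = \<kappa> * (l\<^sup>2 * spat e z)"
  defines "y \<equiv> T *\<^sub>R e + l *\<^sub>R (z - (z \<bullet> e) *\<^sub>R e)"
  shows "y \<bullet> e = T" "spat e y = l\<^sup>2 * spat e z"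
    "swap e y z \<bullet> e = T * (z \<bullet> e) - \<kappa> * l * spat e z"
proof -
  let ?Z = "z - (z \<bullet> e) *\<^sub>R e"
  have Z: "?Z \<bullet> e = 0" using unit by (simp add: inner_diff_left)
  show ye: "y \<bullet> e = T" using Z unit by (simp add: y_def inner_add_left)
  have "y - T *\<^sub>R e = l *\<^sub>R ?Z" by (simp add: y_def)
  then show ys: "spat e y = l\<^sup>2 * spat e z"
    unfolding spat_eq[OF unit, of y] spat_eq[OF unit, of z] ye by (simp add: power2_eq_square)
  have "z \<bullet> ?Z = spat e z" by (simp add: spat_def inner_diff_right power2_eq_square)
  then have zy: "z \<bullet> y = T * (z \<bullet> e) + l * spat e z" by (simp add: y_def inner_add_right)
  have "swap e y z \<bullet> e = z \<bullet> e - (z \<bullet> e - (1 + T) / (l\<^sup>2 * spat e z) * (l * spat e z)) * (1 - T)"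
    unfolding swap_def ye ys zy by (simp add: inner_diff_left unit ye)
  also have "\<dots> = T * (z \<bullet> e) - (T\<^sup>2 - 1) / (l\<^sup>2 * spat e z) * (l * spat e z)"
    by (simp add: power2_eq_square algebra_simps add_divide_distrib diff_divide_distrib)
  also have "(T\<^sup>2 - 1) / (l\<^sup>2 * spat e z) = \<kappa>" using T z l by simp
  finally show "swap e y z \<bullet> e = T * (z \<bullet> e) - \<kappa> * l * spat e z" by simp
qed

text \<open>
  A spacelike orbit point could be moved by a swap to one without time component, and a lightlike
  one to a different point of the same speed.
\<close>

lemma orbit_timelike:
  assumes x0: "x0 \<in> swaps" and z: "z \<in> orbit" shows "kappa x0 * spat e z < (z \<bullet> e)\<^sup>2"
proof (rule ccontr)
  define \<kappa> where "\<kappa> = kappa x0"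
  define s where "s = spat e z"
  define t where "t = z \<bullet> e"
  assume "\<not> ?thesis"
  then have le: "t\<^sup>2 \<le> \<kappa> * s" by (simp add: \<kappa>_def s_def t_def)
  have t0: "t \<noteq> 0" using orbit_time[OF z] by (simp add: t_def)
  then have tp: "t\<^sup>2 > 0" by simp
  then have ks: "\<kappa> * s > 0" using le by linarith
  have s0: "s \<ge> 0" using spat_nonneg[OF unit] by (simp add: s_def)
  have sp: "s > 0" "\<kappa> > 0" using ks s0 by (auto simp: zero_less_mult_iff)
  have sn: "s \<noteq> 0" using sp by simp
  note sw = swap_time[of z _ _ \<kappa>, folded s_def t_def]
  consider "t\<^sup>2 < \<kappa> * s" | "t\<^sup>2 = \<kappa> * s" using le by linarith
  then show False
  proof cases
    case 1
    \<comment> \<open>Parameters of the boost for which \<open>T * t - \<kappa> * l * s\<close>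
      vanishes; \<open>T\<close> is the Lorentz factor for the squared relative speed
      \<open>q\<close>.\<close>
    define q where "q = t\<^sup>2 / (\<kappa> * s)"
    define T where "T = 1 / sqrt (1 - q)"
    define l where "l = T * t / (\<kappa> * s)"
    have q: "0 < q" "q < 1" using 1 tp ks by (simp_all add: q_def)
    then have T1: "T \<ge> 1" by (simp add: T_def)
    have "T\<^sup>2 = 1 / (1 - q)" using q by (simp add: T_def power_divide)
    then have "T\<^sup>2 * (1 - q) = 1" using q by simp
    moreover have "\<kappa> * (l\<^sup>2 * s) = T\<^sup>2 * q"
      using sp by (simp add: l_def q_def power2_eq_square field_simps)
    ultimately have Tk: "T\<^sup>2 - 1 = \<kappa> * (l\<^sup>2 * s)" by (simp add: algebra_simps)
    have l0: "l \<noteq> 0" using T1 t0 sp by (simp add: l_def)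
    let ?y = "T *\<^sub>R e + l *\<^sub>R (z - t *\<^sub>R e)"
    note y = sw[OF sn l0 Tk]
    have "?y \<in> swaps"
      using y sp T1 Tk l0 by (intro swaps_exist[OF x0]) (simp_all add: \<kappa>_def[symmetric])
    then have "swap e ?y z \<in> orbit" using orbit_act[OF _ z] by (simp add: swaps_def)
    moreover have "swap e ?y z \<bullet> e = 0" using y(3) sp by (simp add: l_def)
    ultimately show False using orbit_time by blast
  next
    case 2
    \<comment> \<open>The boost with Lorentz factor \<open>5 / 4\<close> takes the time component
      \<open>t\<close> to \<open>5 / 4 * t - 3 / 4 * t = t / 2\<close>, while the point stays
      lightlike.\<close>
    define l where "l = 3 / (4 * t)"
    have "l\<^sup>2 * t\<^sup>2 = 9 / 16" using t0 by (simp add: l_def power2_eq_square)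
    moreover have "\<kappa> * (l\<^sup>2 * s) = l\<^sup>2 * t\<^sup>2" unfolding 2 by simp
    ultimately have *: "\<kappa> * (l\<^sup>2 * s) = 9 / 16" by metis
    have Tk: "(5/4)\<^sup>2 - 1 = \<kappa> * (l\<^sup>2 * s)" unfolding * by (simp add: power2_eq_square)
    have l0: "l \<noteq> 0" using t0 by (simp add: l_def)
    let ?y = "(5/4) *\<^sub>R e + l *\<^sub>R (z - t *\<^sub>R e)"
    let ?z = "swap e ?y z"
    note y = sw[OF sn l0 Tk]
    have f: "(?y \<bullet> e)\<^sup>2 - \<kappa> * spat e ?y = 1" unfolding y(1,2) using Tk by linarith
    have y1: "?y \<bullet> e \<ge> 1" unfolding y(1) by simp
    have y0: "spat e ?y \<noteq> 0" unfolding y(2) using l0 sp by simp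
    have ys: "?y \<in> swaps" by (rule swaps_exist[OF x0 y1 y0 f[unfolded \<kappa>_def]])
    then have zo: "?z \<in> orbit" using orbit_act[OF _ z] by (simp add: swaps_def)
    have "\<kappa> * l * s = l * t\<^sup>2" unfolding 2 by simp
    also have "\<dots> = 3 / 4 * t" using t0 by (simp add: l_def power2_eq_square)
    finally have zt: "?z \<bullet> e = t / 2" unfolding y(3) by simp
    have "swap e ?y \<in> form_group e \<kappa>"
      using y1 by (intro swap_form_group[OF unit y0 f]) simp
    then have "form e \<kappa> ?z ?z = form e \<kappa> z z" by (simp add: form_group_def)
    then have k: "(t / 2)\<^sup>2 = \<kappa> * spat e ?z" using 2 unfolding form_inner_self[OF unit] zt by (simp add: s_def t_def)
    have "\<kappa> * (spat e z * (?z \<bullet> e)\<^sup>2) = (\<kappa> * s) * (t / 2)\<^sup>2" unfolding zt by (simp only: s_def mult.assoc)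
    also have "\<dots> = \<kappa> * (spat e ?z * (z \<bullet> e)\<^sup>2)" unfolding k 2[symmetric] by (simp only: t_def mult_ac)
    finally have "spat e z * (?z \<bullet> e)\<^sup>2 = spat e ?z * (z \<bullet> e)\<^sup>2" using sp by simp
    from orbit_speed(1)[OF z zo this] show False using zt t0 by (simp add: t_def)
  qed
qed

text \<open>Being timelike, \<open>z\<close> can be scaled by \<open>c\<close> to value
  \<open>1\<close> under the form, with positive time component. The scaled point is a swap by
  \<open>swaps_exist\<close>, and \<open>orbit_ray\<close> gives \<open>c = 1\<close>.\<close>

lemma orbit_swaps:
  assumes x0: "x0 \<in> swaps" and z: "z \<in> orbit" "spat e z \<noteq> 0"
  shows "z \<in> swaps \<and> z \<bullet> e \<ge> 1 \<and> (z \<bullet> e)\<^sup>2 - kappa x0 * spat e z = 1"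
proof -
  define w where "w = (z \<bullet> e)\<^sup>2 - kappa x0 * spat e z"
  have w: "w > 0" using orbit_timelike[OF x0 z(1)] by (simp add: w_def)
  define c where "c = sgn (z \<bullet> e) / sqrt w"
  have t0: "z \<bullet> e \<noteq> 0" using orbit_time[OF z(1)] .
  have c2: "c\<^sup>2 = 1 / w" using w t0 by (simp add: c_def power_divide power2_eq_square sgn_mult[symmetric] sgn_if)
  let ?y = "c *\<^sub>R z"
  have "(?y \<bullet> e)\<^sup>2 - kappa x0 * spat e ?y = c\<^sup>2 * w"
    by (simp add: spat_scale w_def power_mult_distrib algebra_simps)
  then have f: "(?y \<bullet> e)\<^sup>2 - kappa x0 * spat e ?y = 1" using w c2 by simp
  have "?y \<bullet> e \<ge> 0" using w by (simp add: c_def sgn_if)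
  moreover have "(?y \<bullet> e)\<^sup>2 \<ge> 1\<^sup>2"
    using f mult_nonneg_nonneg[OF kappa_nonneg[OF x0] spat_nonneg[OF unit, of ?y]] by simp
  ultimately have y1: "?y \<bullet> e \<ge> 1" by (metis power2_le_imp_le)
  have "c \<noteq> 0" using w t0 by (simp add: c_def sgn_if)
  then have "spat e ?y \<noteq> 0" using z(2) by (simp add: spat_scale)
  then have y: "?y \<in> swaps" using swaps_exist[OF x0 y1 _ f] by blast
  then have "c = 1" using orbit_ray[OF z(1)] swaps_orbit by blast
  then show ?thesis using y y1 f by simp
qed

text \<open>In both inclusions, composing with the swap of \<open>e\<close> and its image reduces to
  a map fixing \<open>e\<close>; in either group these are the isometries that fix \<open>e\<close>.
  An image on the time axis is already \<open>e\<close>.\<close>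

lemma speed_group_cases: "\<exists>\<kappa>\<ge>0. G = speed_group e \<kappa>"
proof -
  obtain x0 where x0: "x0 \<in> swaps" using swaps_nonempty by blast
  define \<kappa> where "\<kappa> = kappa x0"
  have k0: "\<kappa> \<ge> 0" using kappa_nonneg[OF x0] by (simp add: \<kappa>_def)
  have comp_eq: "L = swap e z \<circ> (swap e z \<circ> L)" if "spat e z \<noteq> 0" for L z
    using swap_swap[OF unit that] by (auto simp: fun_eq_iff)
  have sw: "swap e z \<in> form_group e \<kappa>"
    if "spat e z \<noteq> 0" "(z \<bullet> e)\<^sup>2 - \<kappa> * spat e z = 1" "z \<bullet> e > 0" for z
    using swap_form_group[OF unit that] .
  have "g \<in> speed_group e \<kappa>" if g: "g \<in> G" for g
  proof (cases "spat e (g e) = 0")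
    case True
    have "orthogonal_transformation g \<and> g e = e" using stab[OF g spat_zero[OF unit True]] .
    then show ?thesis using unit by (simp add: speed_group_def orthogonal_form_group[OF unit])
  next
    case False
    let ?z = "g e"
    have z: "?z \<in> swaps" "?z \<bullet> e \<ge> 1" "(?z \<bullet> e)\<^sup>2 - \<kappa> * spat e ?z = 1"
      using orbit_swaps[OF x0 orbitI[OF g] False] by (simp_all add: \<kappa>_def)
    have k: "swap e ?z \<circ> g \<in> G" using z(1) g by (simp add: swaps_def comp)
    have "(swap e ?z \<circ> g) e = 1 *\<^sub>R e" using swap_x[OF unit False] by simp
    from stab[OF k this] have kf: "swap e ?z \<circ> g \<in> form_group e \<kappa>"
      by (simp only: orthogonal_form_group[OF unit])
    have "swap e ?z \<in> form_group e \<kappa>" using z(2) by (intro sw[OF False z(3)]) simp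
    from form_group_comp[OF unit this kf] have "g \<in> form_group e \<kappa>" by (simp only: comp_eq[OF False, of g, symmetric])
    then show ?thesis using z(2) by (simp add: speed_group_def)
  qed
  moreover have "L \<in> G" if L: "L \<in> speed_group e \<kappa>" for L
  proof -
    let ?z = "L e"
    have Lf: "L \<in> form_group e \<kappa>" and pos: "?z \<bullet> e > 0" using L by (simp_all add: speed_group_def)
    have "form e \<kappa> ?z ?z = form e \<kappa> e e" using Lf by (simp add: form_group_def)
    then have f: "(?z \<bullet> e)\<^sup>2 - \<kappa> * spat e ?z = 1"
      by (simp add: form_inner_self[OF unit] unit spat_def)
    show ?thesis
    proof (cases "spat e ?z = 0")
      case True
      then have t: "?z \<bullet> e = 1" using f pos by (simp add: power2_eq_1_iff)
      have "L e = 1 *\<^sub>R e" by (rule spat_zero[OF unit True, unfolded t])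
      then have "L e = e" by simp
      then show ?thesis using orthogonal form_group_orthogonal[OF unit Lf] by blast
    next
      case False
      have "(?z \<bullet> e)\<^sup>2 \<ge> 1\<^sup>2" using f mult_nonneg_nonneg[OF k0 spat_nonneg[OF unit, of ?z]] by simp
      then have "?z \<bullet> e \<ge> 1" using pos by (metis less_imp_le power2_le_imp_le)
      then have z: "?z \<in> swaps" using swaps_exist[OF x0 _ False] f by (simp add: \<kappa>_def)
      have "swap e ?z \<circ> L \<in> form_group e \<kappa>" by (intro form_group_comp[OF unit] sw False f pos Lf)
      moreover have "(swap e ?z \<circ> L) e = e" using swap_x[OF unit False] by simp
      ultimately have "swap e ?z \<circ> L \<in> G" using orthogonal form_group_orthogonal[OF unit] by blast
      from comp[OF _ this, of "swap e ?z"] z have "swap e ?z \<circ> (swap e ?z \<circ> L) \<in> G"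
        by (simp only: swaps_def mem_Collect_eq)
      then show ?thesis by (simp only: comp_eq[OF False, of L, symmetric])
    qed
  qed
  ultimately have "G = speed_group e \<kappa>" by blast
  then show ?thesis using k0 by blast
qed

end

section \<open>Worldview transformations\<close>

abbreviation e_t :: "real ^ 4" where "e_t \<equiv> axis 0 1"

lemma four_index: "(4::4) = 0"
  by simp

lemma tm_inner: "tm p = p \<bullet> e_t" for p :: "real ^ 4"
  by (simp add: tm_def inner_axis)

lemma e_t_unit: "e_t \<bullet> e_t = 1"
  by (simp add: inner_axis)

lemma sp_inner: "sdot (sp p) (sp q) = p \<bullet> q - tm p * tm q" for p q :: "real ^ 4"
  by (simp add: sdot_def sp_def tm_def sum_3 inner_vec_def sum_4 vector_3 four_index)

lemma sp_eq_iff: "sp p = sp q \<longleftrightarrow> p - q = ((p - q) \<bullet> e_t) *\<^sub>R e_t" for p q :: "real ^ 4"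
proof -
  have "(p - q) \<bullet> e_t = p $ 0 - q $ 0" by (simp add: inner_axis)
  then show ?thesis
    by (auto simp: sp_def vec_eq_iff forall_3 forall_4 axis_def vector_3 four_index)
qed

lemma is_line_real: "is_line l \<longleftrightarrow> (\<exists>p v. v \<noteq> 0 \<and> l = range (\<lambda>r. p + r *\<^sub>R v))" for l :: "(real ^ 4) set"
  by (simp add: is_line_def scalar_mult_eq_scaleR full_SetCompr_eq)

lemma range_rebase:
  fixes p v :: "'a::real_vector"
  assumes "x \<in> range (\<lambda>r. p + r *\<^sub>R v)" shows "range (\<lambda>r. p + r *\<^sub>R v) = range (\<lambda>r. x + r *\<^sub>R v)"
proof -
  obtain s where s: "x = p + s *\<^sub>R v" using assms by blast
  have "range (\<lambda>r. x + r *\<^sub>R v) = (\<lambda>r. p + r *\<^sub>R v) ` range (\<lambda>r. s + r)"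
    unfolding image_image s scaleR_left_distrib add.assoc ..
  moreover have "range (\<lambda>r. s + r) = UNIV"
    by (intro surjI[of _ "\<lambda>r. r - s"]) simp
  ultimately show ?thesis by simp
qed

lemma vertical_line_iff: "vertical_line l \<longleftrightarrow> (\<exists>p. l = range (\<lambda>r. p + r *\<^sub>R e_t))"
proof
  assume v: "vertical_line l"
  then obtain p w where w: "w \<noteq> 0" "l = range (\<lambda>r. p + r *\<^sub>R w)"
    by (auto simp: vertical_line_def is_line_real)
  have "p + 1 *\<^sub>R w \<in> l" "p + 0 *\<^sub>R w \<in> l" unfolding w(2) by blast+
  then have "sp (p + 1 *\<^sub>R w) = sp (p + 0 *\<^sub>R w)" using v unfolding vertical_line_def by blast
  then have e: "w = (w \<bullet> e_t) *\<^sub>R e_t" unfolding sp_eq_iff by simp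
  then have "w \<bullet> e_t \<noteq> 0" using w(1) by auto
  then have "l = range (\<lambda>r. p + r *\<^sub>R e_t)" unfolding w(2) by (subst e) (rule range_rescale)
  then show "\<exists>p. l = range (\<lambda>r. p + r *\<^sub>R e_t)" ..
next
  assume "\<exists>p. l = range (\<lambda>r. p + r *\<^sub>R e_t)"
  then obtain p where p: "l = range (\<lambda>r. p + r *\<^sub>R e_t)" ..
  have "e_t \<noteq> 0" using e_t_unit by auto
  then have "is_line l" unfolding p is_line_real by blast
  moreover have "sp x = sp y" if "x \<in> l" "y \<in> l" for x y
  proof -
    obtain r s where "x = p + r *\<^sub>R e_t" "y = p + s *\<^sub>R e_t" using \<open>x \<in> l\<close> \<open>y \<in> l\<close> p by blast
    then have "x - y = (r - s) *\<^sub>R e_t" by (simp add: scaleR_left_diff_distrib)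
    then show ?thesis unfolding sp_eq_iff by (simp only: inner_scaleR_left e_t_unit mult_1_right)
  qed
  ultimately show "vertical_line l" unfolding vertical_line_def by blast
qed

lemma finite_slope_lineD:
  assumes "finite_slope_line l" "x \<in> l"
  obtains v where "v \<bullet> e_t \<noteq> 0" "l = range (\<lambda>r. x + r *\<^sub>R v)"
proof -
  obtain p v where l: "l = range (\<lambda>r. p + r *\<^sub>R v)" and t: "\<exists>y\<in>l. \<exists>z\<in>l. tm y \<noteq> tm z"
    using assms(1) by (auto simp: finite_slope_line_def is_line_real)
  have "v \<bullet> e_t \<noteq> 0" using t unfolding l by (auto simp: tm_inner inner_add_left)
  then show thesis using that range_rebase[of x p v] assms(2) l by metis
qed

lemma image_line_affine:
  fixes p v :: "'a::real_vector"
  assumes "linear L" shows "(\<lambda>x. a + L x) ` range (\<lambda>r. p + r *\<^sub>R v) = range (\<lambda>r. (a + L p) + r *\<^sub>R L v)"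
  by (simp add: image_image linear_add[OF assms] linear_scale[OF assms] add.assoc)

text \<open>Preserving vertical lines makes \<open>L e_t\<close> a multiple of \<open>e_t\<close>;
  orthogonality leaves the factors \<open>1\<close> and \<open>-1\<close>, and orthochrony leaves
  \<open>1\<close>.\<close>

lemma Triv_up_iff:
  "T \<in> Triv_up \<longleftrightarrow> (\<exists>a L. orthogonal_transformation L \<and> L e_t = e_t \<and> T = (\<lambda>x. a + L x))" (is "_ \<longleftrightarrow> ?R")
proof
  assume T: "T \<in> Triv_up"
  then obtain a L where L: "linear L" "\<And>p q. L p \<bullet> L q = p \<bullet> q" "T = (\<lambda>x. a + L x)"
    unfolding Triv_up_def Triv_def linear_vec_real sdot_real by (auto simp: comp_def)
  have "vertical_line (range (\<lambda>r. 0 + r *\<^sub>R e_t))" unfolding vertical_line_iff by blast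
  then have "vertical_line (T ` range (\<lambda>r. 0 + r *\<^sub>R e_t))" using T unfolding Triv_up_def Triv_def by blast
  then have v: "vertical_line (range (\<lambda>r. a + L 0 + r *\<^sub>R L e_t))"
    unfolding L(3) image_line_affine[OF L(1)] .
  have "a + L 0 + 1 *\<^sub>R L e_t \<in> range (\<lambda>r. a + L 0 + r *\<^sub>R L e_t)"
    "a + L 0 + 0 *\<^sub>R L e_t \<in> range (\<lambda>r. a + L 0 + r *\<^sub>R L e_t)" by blast+
  then have "sp (a + L 0 + 1 *\<^sub>R L e_t) = sp (a + L 0 + 0 *\<^sub>R L e_t)" using v unfolding vertical_line_def by blast
  then have "L e_t = (L e_t \<bullet> e_t) *\<^sub>R e_t" unfolding sp_eq_iff by simp
  then obtain c where e: "L e_t = c *\<^sub>R e_t" by blast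
  then have "L e_t \<bullet> L e_t = c\<^sup>2" by (simp add: e_t_unit power2_eq_square)
  then have "c\<^sup>2 = 1" by (simp only: L(2) e_t_unit)
  moreover have "c > 0"
    using T unfolding Triv_up_def orthochronous_def L(3) tm_inner
    by (simp add: inner_add_left linear_0[OF L(1)] e e_t_unit)
  ultimately have "c = 1" by (simp add: power2_eq_1_iff)
  then have "L e_t = e_t" using e by simp
  then show ?R using L by (auto simp: orthogonal_transformation_def)
next
  assume ?R
  then obtain a L where L: "orthogonal_transformation L" "L e_t = e_t" "T = (\<lambda>x. a + L x)" by blast
  have lin: "linear L" using L(1) unfolding orthogonal_transformation_def by blast
  have "vertical_line (T ` l)" if "vertical_line l" for l
  proof -
    obtain p where p: "l = range (\<lambda>r. p + r *\<^sub>R e_t)" using \<open>vertical_line l\<close> unfolding vertical_line_iff by blast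
    show ?thesis unfolding p L(3) image_line_affine[OF lin] L(2) vertical_line_iff by blast
  qed
  moreover have "orthochronous T"
    by (simp add: orthochronous_def L tm_inner inner_add_left linear_0[OF lin] e_t_unit)
  moreover have "T = (+) a \<circ> L" using L(3) by auto
  ultimately show "T \<in> Triv_up"
    using lin L(1) unfolding Triv_up_def Triv_def linear_vec_real sdot_real orthogonal_transformation_def by blast
qed

section \<open>Galilean and Poincare transformations in terms of the forms\<close>

lemma mink_form: "\<kappa> > 0 \<Longrightarrow> mink (1 / sqrt \<kappa>) p q = form e_t \<kappa> p q / \<kappa>"
  by (simp add: mink_def form_def sp_inner tm_inner power_divide field_simps)

lemma orthochronous_affine:
  "linear L \<Longrightarrow> orthochronous (\<lambda>x. a + L x) \<longleftrightarrow> L e_t \<bullet> e_t > 0"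
  by (simp add: orthochronous_def tm_inner inner_add_left linear_0)

text \<open>The translation cancels in orthochrony, which becomes a condition on \<open>L\<close>;
  \<open>P\<close> is left open to serve both kinds of transformations.\<close>

lemma affine_orthochronous:
  "(\<exists>a L. linear L \<and> P L \<and> T = (+) a \<circ> L) \<and> orthochronous T
     \<longleftrightarrow> (\<exists>a L. linear L \<and> P L \<and> L e_t \<bullet> e_t > 0 \<and> T = (\<lambda>x. a + L x))"
proof -
  have c: "(+) a \<circ> L = (\<lambda>x. a + L x)" for a :: "real ^ 4" and L :: "real ^ 4 \<Rightarrow> real ^ 4" by auto
  show ?thesis unfolding c
  proof
    assume "(\<exists>a L. linear L \<and> P L \<and> T = (\<lambda>x. a + L x)) \<and> orthochronous T"
    then obtain a L where L: "linear L" "P L" "T = (\<lambda>x. a + L x)" "orthochronous T" by blast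
    then have "L e_t \<bullet> e_t > 0" using orthochronous_affine[OF L(1), of a] by simp
    with L show "\<exists>a L. linear L \<and> P L \<and> L e_t \<bullet> e_t > 0 \<and> T = (\<lambda>x. a + L x)" by blast
  next
    assume "\<exists>a L. linear L \<and> P L \<and> L e_t \<bullet> e_t > 0 \<and> T = (\<lambda>x. a + L x)"
    then obtain a L where L: "linear L" "P L" "L e_t \<bullet> e_t > 0" "T = (\<lambda>x. a + L x)" by blast
    then have "orthochronous T" using orthochronous_affine[OF L(1), of a] by simp
    with L show "(\<exists>a L. linear L \<and> P L \<and> T = (\<lambda>x. a + L x)) \<and> orthochronous T" by blast
  qed
qed

text \<open>For this \<open>c\<close> the product \<open>mink\<close> is \<open>form\<close> divided
  by \<open>\<kappa>\<close>, so both are preserved by the same maps.\<close>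

lemma Poi_up_speed_group:
  assumes "\<kappa> > 0" shows "Poi_up (1 / sqrt \<kappa>) = {\<lambda>x. a + L x | a L. L \<in> speed_group e_t \<kappa>}"
proof -
  have "T \<in> Poi_up (1 / sqrt \<kappa>) \<longleftrightarrow> (\<exists>a L. L \<in> speed_group e_t \<kappa> \<and> T = (\<lambda>x. a + L x))" for T
    using assms
    unfolding Poi_up_def Poi_def linear_vec_real mem_Collect_eq affine_orthochronous mink_form[OF assms]
    by (simp add: speed_group_def form_group_def conj_assoc)
  then show ?thesis by blast
qed

text \<open>The absolute value leaves a sign that might depend on \<open>p\<close>; linearity and
  positivity at \<open>e_t\<close> make it the positive one everywhere.\<close>

lemma abs_time_iff_form:
  assumes L: "linear L" and pos: "L e_t \<bullet> e_t > 0"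
  shows "(\<forall>p. \<bar>tm (L p)\<bar> = \<bar>tm p\<bar>) \<longleftrightarrow> (\<forall>p q. form e_t 0 (L p) (L q) = form e_t 0 p q)"
proof
  assume a: "\<forall>p. \<bar>tm (L p)\<bar> = \<bar>tm p\<bar>"
  have "L p \<bullet> e_t = p \<bullet> e_t" for p
  proof -
    define s where "s = p - (p \<bullet> e_t) *\<^sub>R e_t"
    have "tm s = 0" by (simp add: s_def tm_inner inner_diff_left e_t_unit)
    then have "L s \<bullet> e_t = 0" using a[rule_format, of s] by (simp add: tm_inner)
    moreover have "L e_t \<bullet> e_t = 1" using a[rule_format, of e_t] pos by (simp add: tm_inner e_t_unit)
    ultimately show ?thesis
      by (simp add: s_def linear_diff[OF L] linear_scale[OF L] inner_diff_left)
  qed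
  then show "\<forall>p q. form e_t 0 (L p) (L q) = form e_t 0 p q" by (simp add: form_def)
next
  assume f: "\<forall>p q. form e_t 0 (L p) (L q) = form e_t 0 p q"
  have "(L p \<bullet> e_t)\<^sup>2 = (p \<bullet> e_t)\<^sup>2" for p
    using f[rule_format, of p p] by (simp add: form_def power2_eq_square)
  then show "\<forall>p. \<bar>tm (L p)\<bar> = \<bar>tm p\<bar>" by (metis tm_inner real_sqrt_abs)
qed

lemma Gal_up_speed_group: "Gal_up = {\<lambda>x. a + L x | a L. L \<in> speed_group e_t 0}"
proof -
  have key: "linear L \<and> ((\<forall>p. \<bar>tm (L p)\<bar> = \<bar>tm p\<bar>)
      \<and> (\<forall>p q. p \<bullet> e_t = 0 \<and> q \<bullet> e_t = 0 \<longrightarrow> L p \<bullet> L q = p \<bullet> q)) \<and> L e_t \<bullet> e_t > 0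
    \<longleftrightarrow> L \<in> speed_group e_t 0" for L
    using abs_time_iff_form[of L] by (auto simp: speed_group_def form_group_def)
  have "T \<in> Gal_up \<longleftrightarrow> (\<exists>a L. L \<in> speed_group e_t 0 \<and> T = (\<lambda>x. a + L x))" for T
  proof -
    have "T \<in> Gal_up \<longleftrightarrow> (\<exists>a L. linear L \<and> ((\<forall>p. \<bar>tm (L p)\<bar> = \<bar>tm p\<bar>)
        \<and> (\<forall>p q. p \<bullet> e_t = 0 \<and> q \<bullet> e_t = 0 \<longrightarrow> L p \<bullet> L q = p \<bullet> q))
        \<and> L e_t \<bullet> e_t > 0 \<and> T = (\<lambda>x. a + L x))"
      unfolding affine_orthochronous[symmetric] Gal_up_def Gal_def linear_vec_real sdot_real
      by (simp add: tm_inner conj_assoc)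
    also have "\<dots> \<longleftrightarrow> (\<exists>a L. L \<in> speed_group e_t 0 \<and> T = (\<lambda>x. a + L x))"
      unfolding key[symmetric] by blast
    finally show ?thesis .
  qed
  then show ?thesis by blast
qed

text \<open>What the axioms say about worldviews as a set of maps: \<open>comp\<close> rests on
  Axiom IV, \<open>trivial\<close> and \<open>rest\<close> on Axiom II, \<open>slope\<close> on BA3
  and BA4, \<open>moving\<close> on Axiom I.\<close>

locale worldview_group =
  fixes W :: "(real ^ 4 \<Rightarrow> real ^ 4) set"
  assumes comp: "f \<in> W \<Longrightarrow> g \<in> W \<Longrightarrow> f \<circ> g \<in> W"
    and inverse: "f \<in> W \<Longrightarrow> \<exists>g\<in>W. g \<circ> f = id \<and> f \<circ> g = id"
    and trivial: "Triv_up \<subseteq> W"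
    and slope: "f \<in> W \<Longrightarrow> vertical_line l \<Longrightarrow> finite_slope_line (f ` l)"
    and rest: "f \<in> W \<Longrightarrow> (\<And>l. vertical_line l \<Longrightarrow> vertical_line (f ` l)) \<Longrightarrow> f \<in> Triv_up"
    and moving: "\<exists>f\<in>W. \<exists>l. vertical_line l \<and> \<not> vertical_line (f ` l)"
begin

section \<open>Affinity and linear parts\<close>

lemma trivialI: "orthogonal_transformation L \<Longrightarrow> L e_t = e_t \<Longrightarrow> (\<lambda>x. a + L x) \<in> W"
  using trivial Triv_up_iff by blast

lemma translation: "(\<lambda>x. a + x) \<in> W"
  using trivialI[of "\<lambda>x. x" a] by (simp add: orthogonal_transformation_def)

lemma inj: "f \<in> W \<Longrightarrow> inj f"
  using inverse by (metis inj_on_id inj_on_imageI2)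

lemma finite_slope_line_dir:
  fixes f :: "real ^ 4 \<Rightarrow> real ^ 4"
  assumes "finite_slope_line (f ` range (\<lambda>r. p + r *\<^sub>R d))"
  shows "\<exists>w. w \<noteq> 0 \<and> range (\<lambda>r. f (p + r *\<^sub>R d)) = range (\<lambda>r. f p + r *\<^sub>R w)"
proof -
  have "p \<in> range (\<lambda>r. p + r *\<^sub>R d)" by (rule range_eqI[of _ _ 0]) simp
  then have "f p \<in> f ` range (\<lambda>r. p + r *\<^sub>R d)" by (rule imageI)
  from finite_slope_lineD[OF assms this] obtain w where
    "w \<bullet> e_t \<noteq> 0" "f ` range (\<lambda>r. p + r *\<^sub>R d) = range (\<lambda>r. f p + r *\<^sub>R w)" by blast
  then have "w \<noteq> 0" "range (\<lambda>r. f (p + r *\<^sub>R d)) = range (\<lambda>r. f p + r *\<^sub>R w)"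
    by (auto simp: image_image)
  then show ?thesis by blast
qed

text \<open>Some \<open>f\<close> takes a vertical line to one of direction \<open>e_t + s\<close>
  with \<open>s\<close> nonzero and spatial. Trivial transformations carry this line to all lines of
  speed \<open>norm s\<close>, which are thus images of vertical lines; \<open>g\<close> takes them
  to lines, and \<open>cone_affine\<close> applies.\<close>

lemma affine:
  assumes g: "g \<in> W" shows "linear (\<lambda>x. g x - g 0)"
proof -
  obtain f l where f: "f \<in> W" "vertical_line l" "\<not> vertical_line (f ` l)" using moving by blast
  obtain x where "x \<in> f ` l" using f(2) by (auto simp: vertical_line_iff)
  from finite_slope_lineD[OF slope[OF f(1,2)] this] obtain v where
    v: "v \<bullet> e_t \<noteq> 0" "f ` l = range (\<lambda>r. x + r *\<^sub>R v)" by blast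
  define w where "w = (1 / (v \<bullet> e_t)) *\<^sub>R v"
  have fl: "f ` l = range (\<lambda>r. x + r *\<^sub>R w)" unfolding v(2) w_def using v(1) by (intro range_rescale[symmetric]) simp
  have we: "w \<bullet> e_t = 1" using v(1) by (simp add: w_def)
  define s where "s = w - e_t"
  have se: "s \<bullet> e_t = 0" using we by (simp add: s_def inner_diff_left e_t_unit)
  have "s \<noteq> 0" using f(3) fl by (auto simp: s_def vertical_line_iff)
  have "line_dir g (e_t + norm s *\<^sub>R u)" if u: "u \<bullet> u = 1" "u \<bullet> e_t = 0" for u
    unfolding line_dir_def
  proof
    fix p
    have "w \<bullet> e_t = (e_t + norm s *\<^sub>R u) \<bullet> e_t" using we u by (simp add: inner_add_left e_t_unit)
    moreover have "w \<bullet> w = (e_t + norm s *\<^sub>R u) \<bullet> (e_t + norm s *\<^sub>R u)"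
    proof -
      have "w = e_t + s" by (simp add: s_def)
      then have "w \<bullet> w = 1 + s \<bullet> s"
        using se by (simp add: inner_add_left inner_add_right inner_commute[of e_t s] e_t_unit)
      moreover have "(e_t + norm s *\<^sub>R u) \<bullet> (e_t + norm s *\<^sub>R u) = 1 + norm s * norm s"
        using u by (simp add: inner_add_left inner_add_right inner_commute[of e_t u] e_t_unit)
      ultimately show ?thesis by (simp add: dot_square_norm power2_eq_square)
    qed
    ultimately obtain k where k: "orthogonal_transformation k" "k e_t = e_t" "k w = e_t + norm s *\<^sub>R u"
      using isotropic by metis
    \<comment> \<open>The translation is chosen so that \<open>x\<close> goes to
      \<open>p\<close>.\<close>
    define \<phi> where "\<phi> = (\<lambda>y. (p - k x) + k y)"
    have "\<phi> \<in> W" unfolding \<phi>_def by (rule trivialI[OF k(1,2)])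
    then have "finite_slope_line ((g \<circ> (\<phi> \<circ> f)) ` l)" by (intro slope comp g f)
    moreover have "linear k" using k(1) by (simp add: orthogonal_transformation_def)
    then have "\<phi> ` f ` l = range (\<lambda>r. p + r *\<^sub>R (e_t + norm s *\<^sub>R u))"
      unfolding fl \<phi>_def image_line_affine k(3) by (simp add: image_line_affine k(3))
    ultimately have "finite_slope_line (g ` range (\<lambda>r. p + r *\<^sub>R (e_t + norm s *\<^sub>R u)))"
      by (simp only: image_comp[symmetric])
    then show "\<exists>w. w \<noteq> 0 \<and> range (\<lambda>r. g (p + r *\<^sub>R (e_t + norm s *\<^sub>R u))) = range (\<lambda>r. g p + r *\<^sub>R w)"
      by (rule finite_slope_line_dir)
  qed
  moreover have "line_dir g e_t"
    unfolding line_dir_def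
  proof
    fix p
    have "vertical_line (range (\<lambda>r. p + r *\<^sub>R e_t))" by (auto simp: vertical_line_iff)
    then show "\<exists>w. w \<noteq> 0 \<and> range (\<lambda>r. g (p + r *\<^sub>R e_t)) = range (\<lambda>r. g p + r *\<^sub>R w)"
      by (intro finite_slope_line_dir slope g)
  qed
  ultimately show ?thesis
    using cone_affine[OF _ e_t_unit _ inj[OF g], of "norm s"] \<open>s \<noteq> 0\<close> by simp
qed

lemma linear_time:
  assumes "g \<in> W" "linear g" shows "g e_t \<bullet> e_t \<noteq> 0"
proof -
  have "vertical_line (range (\<lambda>r. 0 + r *\<^sub>R e_t))" unfolding vertical_line_iff by blast
  from slope[OF assms(1) this] have "finite_slope_line (range (\<lambda>r. r *\<^sub>R g e_t))"
    by (simp add: image_image linear_scale[OF assms(2)])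
  then show ?thesis by (auto simp: finite_slope_line_def tm_inner)
qed

lemma vertical_preserved:
  assumes "g \<in> W" "linear g" "g e_t = c *\<^sub>R e_t" "vertical_line l"
  shows "vertical_line ((\<lambda>x. a + g x) ` l)"
proof -
  obtain p where p: "l = range (\<lambda>r. p + r *\<^sub>R e_t)" using assms(4) unfolding vertical_line_iff by blast
  have "c \<noteq> 0" using linear_time[OF assms(1,2)] assms(3) by auto
  then show ?thesis
    unfolding p image_line_affine[OF assms(2)] assms(3) range_rescale[OF \<open>c \<noteq> 0\<close>] vertical_line_iff by blast
qed

lemma linear_part: "f \<in> W \<Longrightarrow> (\<lambda>x. f x - f 0) \<in> W"
  using comp[OF translation[of "- f 0"], of f] by (simp add: comp_def)

sublocale linear: isotropic_group "{g \<in> W. linear g}" e_t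
proof (rule isotropic_group.intro)
  show "3 \<le> DIM(real ^ 4)" by simp
  show "e_t \<bullet> e_t = 1" by (rule e_t_unit)
  show "linear g" if "g \<in> {g \<in> W. linear g}" for g using that by simp
  show "g \<circ> h \<in> {g \<in> W. linear g}" if "g \<in> {g \<in> W. linear g}" "h \<in> {g \<in> W. linear g}" for g h
    using that by (simp add: comp linear_compose)
  show "\<exists>h\<in>{g \<in> W. linear g}. h \<circ> g = id \<and> g \<circ> h = id" if "g \<in> {g \<in> W. linear g}" for g
  proof -
    obtain h where h: "h \<in> W" "h \<circ> g = id" "g \<circ> h = id" using inverse \<open>g \<in> _\<close> by blast
    have "h 0 = h (g 0)" using that linear_0[of g] by simp
    also have "\<dots> = 0" using h(2) by (metis comp_apply id_apply)
    finally have "linear h" using affine[OF h(1)] by simp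
    then show ?thesis using h by blast
  qed
  show "k \<in> {g \<in> W. linear g}" if "orthogonal_transformation k" "k e_t = e_t" for k
    using trivialI[OF that, of 0] that by (simp add: orthogonal_transformation_def)
  show "g e_t \<bullet> e_t \<noteq> 0" if "g \<in> {g \<in> W. linear g}" for g
    using that linear_time by simp
  show "orthogonal_transformation g \<and> g e_t = e_t"
    if g: "g \<in> {g \<in> W. linear g}" "g e_t = c *\<^sub>R e_t" for g c
  proof -
    have gW: "g \<in> W" "linear g" using g(1) by simp_all
    have "vertical_line (g ` l)" if "vertical_line l" for l
      using vertical_preserved[OF gW g(2) that, of 0] by simp
    then have "g \<in> Triv_up" using rest gW(1) by blast
    then obtain a L where L: "orthogonal_transformation L" "L e_t = e_t" "g = (\<lambda>x. a + L x)"
      unfolding Triv_up_iff by blast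
    have "g 0 = 0" "L 0 = 0" using g(1) L(1) by (simp_all add: linear_0 orthogonal_transformation_def)
    then have "g = L" using L(3) by simp
    then show ?thesis using L by simp
  qed
  show "\<exists>g\<in>{g \<in> W. linear g}. \<forall>c. g e_t \<noteq> c *\<^sub>R e_t"
  proof -
    obtain f l where f: "f \<in> W" "vertical_line l" "\<not> vertical_line (f ` l)" using moving by blast
    let ?L = "\<lambda>x. f x - f 0"
    have "?L e_t \<noteq> c *\<^sub>R e_t" for c
    proof
      assume "?L e_t = c *\<^sub>R e_t"
      from vertical_preserved[OF linear_part[OF f(1)] affine[OF f(1)] this f(2), of "f 0"]
      show False using f(3) by simp
    qed
    then show ?thesis
      using linear_part[OF f(1)] affine[OF f(1)] by (intro bexI[of _ ?L]) simp_all
  qed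
qed

lemma affine_decomposition: "W = {\<lambda>x. a + L x | a L. L \<in> {g \<in> W. linear g}}"
proof (intro equalityI subsetI)
  fix f assume f: "f \<in> W"
  have "f = (\<lambda>x. f 0 + (f x - f 0))" by simp
  then show "f \<in> {\<lambda>x. a + L x | a L. L \<in> {g \<in> W. linear g}}"
    using linear_part[OF f] affine[OF f] unfolding mem_Collect_eq
    by (intro exI[of _ "f 0"] exI[of _ "\<lambda>x. f x - f 0"]) simp
next
  fix f assume "f \<in> {\<lambda>x. a + L x | a L. L \<in> {g \<in> W. linear g}}"
  then obtain a L where "L \<in> W" "f = (\<lambda>x. a + L x)" by blast
  then show "f \<in> W" using comp[OF translation[of a], of L] by (simp add: comp_def)
qed

lemma Gal_or_Poi: "W = Gal_up \<or> (\<exists>c>0. W = Poi_up c)"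
proof -
  obtain \<kappa> where k: "\<kappa> \<ge> 0" "{g \<in> W. linear g} = speed_group e_t \<kappa>" using linear.speed_group_cases by blast
  have W: "W = {\<lambda>x. a + L x | a L. L \<in> speed_group e_t \<kappa>}"
    using affine_decomposition unfolding k(2) .
  show ?thesis
  proof (cases "\<kappa> = 0")
    case True
    then show ?thesis using W Gal_up_speed_group by simp
  next
    case False
    then have "\<kappa> > 0" using k(1) by simp
    then have "W = Poi_up (1 / sqrt \<kappa>)" "1 / sqrt \<kappa> > 0" using W Poi_up_speed_group by simp_all
    then show ?thesis by blast
  qed
qed

end

section \<open>From models to the group of worldview transformations\<close>

lemma coord_event: "is_model M \<Longrightarrow> (x, p) \<in> coord M k \<Longrightarrow> x \<in> Ev M"
  by (auto simp: is_model_def coord_def)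

text \<open>BA2 makes the relation under the \<open>THE\<close> functional and total; afterwards
  values are found by exhibiting a common event.\<close>

lemma worldview_eq_iff:
  assumes M: "is_model M" "BA2 M" and kh: "k \<in> IOb M" "h \<in> IOb M"
  shows "worldview M k h p = q \<longleftrightarrow> (\<exists>x. (x, p) \<in> coord M h \<and> (x, q) \<in> coord M k)"
proof -
  note ev = coord_event[OF M(1)]
  have ex: "\<exists>!q. (p, q) \<in> (coord M h)\<inverse> O coord M k"
  proof -
    obtain x where x: "x \<in> Ev M" "(x, p) \<in> coord M h"
      "\<And>y. y \<in> Ev M \<Longrightarrow> (y, p) \<in> coord M h \<Longrightarrow> y = x"
      using M(2) kh(2) unfolding BA2_def by metis
    obtain q where q: "(x, q) \<in> coord M k" "\<And>q'. (x, q') \<in> coord M k \<Longrightarrow> q' = q"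
      using M(2) kh(1) x(1) unfolding BA2_def by metis
    show ?thesis
    proof (rule ex1I[of _ q])
      show "(p, q) \<in> (coord M h)\<inverse> O coord M k" using x(2) q(1) by blast
      show "q' = q" if "(p, q') \<in> (coord M h)\<inverse> O coord M k" for q'
      proof -
        obtain y where y: "(y, p) \<in> coord M h" "(y, q') \<in> coord M k" using \<open>(p, q') \<in> _\<close> by blast
        then have "y = x" using x(3) ev by blast
        then show ?thesis using y q(2) by blast
      qed
    qed
  qed
  have "(p, worldview M k h p) \<in> (coord M h)\<inverse> O coord M k"
    unfolding worldview_def by (rule theI'[OF ex])
  moreover have "worldview M k h p = q" if "(p, q) \<in> (coord M h)\<inverse> O coord M k"
    unfolding worldview_def by (rule the1_equality[OF ex that])
  ultimately have "worldview M k h p = q \<longleftrightarrow> (p, q) \<in> (coord M h)\<inverse> O coord M k" by metis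
  then show ?thesis by auto
qed

lemma worldview_group_worldviews:
  fixes M :: "('e, 'i, 'o, real) model"
  assumes mod: "is_model M" and ba2: "BA2 M" and ba3: "BA3 M" and ba4: "BA4 M"
    and ax1: "AxI M" and ax2: "AxII M" and ax4: "AxIV M"
  shows "worldview_group (worldviews M)"
proof -
  note wv = worldview_eq_iff[OF mod ba2]
  have point: "\<exists>x. (x, p) \<in> coord M k" if "k \<in> IOb M" for k p
    using ba2 that unfolding BA2_def by metis
  have image: "\<exists>q. (x, q) \<in> coord M k" if "k \<in> IOb M" "(x, p) \<in> coord M h" for x p k h
    using ba2 that(1) coord_event[OF mod that(2)] unfolding BA2_def by blast
  have self: "worldview M k k = id" if k: "k \<in> IOb M" for k
  proof
    fix p show "worldview M k k p = id p" using point[OF k, of p] by (auto simp: wv[OF k k])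
  qed
  have chain: "worldview M k h \<circ> worldview M h m = worldview M k m"
    if k: "k \<in> IOb M" and h: "h \<in> IOb M" and m: "m \<in> IOb M" for k h m
  proof
    fix p
    obtain x where x: "(x, p) \<in> coord M m" using point[OF m] by blast
    obtain q where q: "(x, q) \<in> coord M h" using image[OF h x] by blast
    obtain r where r: "(x, r) \<in> coord M k" using image[OF k x] by blast
    have "worldview M h m p = q" "worldview M k h q = r" "worldview M k m p = r"
      using x q r by (auto simp: wv k h m)
    then show "(worldview M k h \<circ> worldview M h m) p = worldview M k m p" by simp
  qed
  have wl: "worldline M k i = worldview M k h ` worldline M h i"
    if k: "k \<in> IOb M" and h: "h \<in> IOb M" for k h i
  proof (intro equalityI subsetI)
    fix q assume "q \<in> worldline M k i"
    then obtain x where x: "x \<in> Ev M" "(i, x) \<in> Prel M" "(x, q) \<in> coord M k" by (auto simp: worldline_def)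
    obtain p where p: "(x, p) \<in> coord M h" using image[OF h x(3)] by blast
    then have "worldview M k h p = q" using x by (auto simp: wv[OF k h])
    moreover have "p \<in> worldline M h i" using x p by (auto simp: worldline_def)
    ultimately show "q \<in> worldview M k h ` worldline M h i" by blast
  next
    fix q assume "q \<in> worldview M k h ` worldline M h i"
    then obtain x p where x: "x \<in> Ev M" "(i, x) \<in> Prel M" "(x, p) \<in> coord M h" "q = worldview M k h p"
      by (auto simp: worldline_def)
    obtain q' where q': "(x, q') \<in> coord M k" using image[OF k x(3)] by blast
    then have "worldview M k h p = q'" using x by (auto simp: wv[OF k h])
    then show "q \<in> worldline M k i" using x q' by (auto simp: worldline_def)
  qed
  show ?thesis
  proof
    fix f g assume "f \<in> worldviews M" "g \<in> worldviews M"
    then obtain k h m n where o: "f = worldview M k h" "g = worldview M m n"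
      "k \<in> IOb M" "h \<in> IOb M" "m \<in> IOb M" "n \<in> IOb M" by (auto simp: worldviews_def)
    \<comment> \<open>Axiom IV rewrites \<open>g\<close> to start from the observer \<open>h\<close>
      of \<open>f\<close>, so that the composition telescopes.\<close>
    obtain n' where "n' \<in> IOb M" "worldview M h n' = g" using ax4 o unfolding AxIV_def by metis
    then show "f \<circ> g \<in> worldviews M" using chain[of k h n'] o by (auto simp: worldviews_def)
  next
    fix f assume "f \<in> worldviews M"
    then obtain k h where "f = worldview M k h" "k \<in> IOb M" "h \<in> IOb M" by (auto simp: worldviews_def)
    then show "\<exists>g\<in>worldviews M. g \<circ> f = id \<and> f \<circ> g = id"
      using chain[of h k h] chain[of k h k] self
      by (intro bexI[of _ "worldview M h k"]) (auto simp: worldviews_def)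
  next
    show "Triv_up \<subseteq> worldviews M"
    proof
      fix \<phi> :: "real trafo" assume "\<phi> \<in> Triv_up"
      moreover obtain k where "k \<in> IOb M" using mod unfolding is_model_def by blast
      ultimately obtain h where "h \<in> IOb M" "worldview M k h = \<phi>" using ax2 unfolding AxII_def by blast
      with \<open>k \<in> IOb M\<close> show "\<phi> \<in> worldviews M" by (auto simp: worldviews_def)
    qed
  next
    fix f and l :: "(real ^ 4) set" assume "f \<in> worldviews M" and l: "vertical_line l"
    then obtain k h where o: "f = worldview M k h" "k \<in> IOb M" "h \<in> IOb M" by (auto simp: worldviews_def)
    obtain i where "i \<in> IM M" "worldline M h i = l" using ba3 o l unfolding BA3_def by blast
    then show "finite_slope_line (f ` l)" using ba4 wl[OF o(2,3)] o unfolding BA4_def by metis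
  next
    fix f assume "f \<in> worldviews M" and v: "\<And>l. vertical_line l \<Longrightarrow> vertical_line (f ` l)"
    then obtain k h where o: "f = worldview M k h" "k \<in> IOb M" "h \<in> IOb M" by (auto simp: worldviews_def)
    then have "at_rest M h k" using v wl[OF o(2,3)] unfolding at_rest_def stationary_def by simp
    then show "f \<in> Triv_up" using ax2 o unfolding AxII_def by blast
  next
    obtain k h i where o: "k \<in> IOb M" "h \<in> IOb M" "stationary M i h" "\<not> stationary M i k"
      using ax1 unfolding AxI_def at_rest_def by blast
    then show "\<exists>f\<in>worldviews M. \<exists>l. vertical_line l \<and> \<not> vertical_line (f ` l)"
      unfolding stationary_def worldviews_def wl[OF o(1,2)] by blast
  qed
qed

theorem theorem7:
  fixes M :: "('e, 'i, 'o, real) model"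
  assumes "is_model M"
    and "BA2 M" and "BA3 M" and "BA4 M"
    and "AxI M" and "AxII M" and "AxIV M"
  shows "worldviews M = Gal_up \<or> (\<exists>c>0. worldviews M = Poi_up c)"
  using worldview_group.Gal_or_Poi[OF worldview_group_worldviews[OF assms]] .

end
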